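(* Let $G$ be a multipartite block fan with centre $x$. Then $G$ is an exact $6$-leaf power if and only if $\rho_x(G)\le 2$.
   Context: Graphs are finite, simple, undirected. A graph $G$ is an exact $k$-leaf power if there is a tree $T$ whose leaf set is $V(G)$ such that for distinct $u,v\in V(G)$, $uv\in E(G)$ if and only if $\operatorname{dist}_T(u,v)=k$. A connected graph is block-complete multipartite if every block of it is a complete multipartite graph. A multipartite block fan with centre $x$ is a connected block-complete multipartite graph with a distinguished cutvertex $x$ such that every block contains $x$ and any two distinct blocks meet exactly in $x$ (thus $x$ is the only cutvertex). For a block $B$, $P_B(x)$ denotes the partite class of $B$ containing $x$. Let $$\rho_x(G)=\bigl|\{B : B\text{ is a block of }G\text{ with at least three partite classes and }|P_B(x)|\ge2\}\bigr|.$$ *)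

theory Defs
  imports "Graph_Theory.Graph_Theory" "HOL-Library.Disjoint_Sets"
begin

text \<open>
  A finite simple undirected graph is a \<open>graph\<close> of the session \<open>Graph_Theory\<close>: a finite symmetric
  digraph without loops and without parallel arcs, every undirected edge being a pair of opposite
  arcs. The name \<open>connected\<close> is qualified because it also denotes the topological notion.
\<close>

subsection \<open>Exact leaf powers\<close>

text \<open>
  The library constant \<open>tree\<close> only excludes directed cycles, and in a symmetric digraph the walk
  \<open>a, b, a\<close> is such a cycle. The cycles of a simple undirected graph are those of length at least 3.
\<close>

definition undirected_tree :: "('a, 'b) pre_digraph \<Rightarrow> bool" where
  "undirected_tree T \<longleftrightarrow>
     graph T \<and> Digraph_Component.connected T \<and> \<not> (\<exists>p. pre_digraph.cycle T p \<and> 3 \<le> length p)"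

text \<open>In a symmetric digraph the out-degree is the degree of the underlying undirected graph.\<close>

definition leaves :: "('a, 'b) pre_digraph \<Rightarrow> 'a set" where
  "leaves T = {v \<in> verts T. out_degree T v = 1}"

text \<open>
  The vertices of \<open>T\<close> are drawn from \<open>'a + nat\<close>, so that there are enough of them for the inner
  vertices even if \<open>'a\<close> is finite; a vertex \<open>v\<close> of \<open>G\<close> is identified with the leaf \<open>Inl v\<close>.
  With unit weights \<open>\<mu>\<close> is the usual graph distance.
\<close>

definition exact_leaf_power :: "nat \<Rightarrow> ('a, 'b) pre_digraph \<Rightarrow> bool" where
  "exact_leaf_power k G \<longleftrightarrow>
     graph G \<and>
     (\<exists>T :: ('a + nat) pair_pre_digraph.
        undirected_tree (with_proj T) \<and>
        leaves (with_proj T) = Inl ` verts G \<and>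
        (\<forall>u \<in> verts G. \<forall>v \<in> verts G. u \<noteq> v \<longrightarrow>
           (u \<rightarrow>\<^bsub>G\<^esub> v \<longleftrightarrow>
            wf_digraph.\<mu> (with_proj T) (\<lambda>_. 1) (Inl u) (Inl v) = ereal (real k))))"

subsection \<open>Cutvertices and blocks\<close>

text \<open>In a symmetric digraph the strongly connected components are the connected components.\<close>

definition cutvertex :: "('a, 'b) pre_digraph \<Rightarrow> 'a \<Rightarrow> bool" where
  "cutvertex G v \<longleftrightarrow>
     v \<in> verts G \<and>
     card (pre_digraph.sccs_verts G) < card (pre_digraph.sccs_verts (pre_digraph.del_vert G v))"

text \<open>
  A block is a maximal connected subgraph without a cutvertex of its own. The condition \<open>graph H\<close> is
  needed because \<open>subgraph\<close> would also allow to drop only one of two opposite arcs.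
\<close>

definition blocks :: "('a, 'b) pre_digraph \<Rightarrow> ('a, 'b) pre_digraph set" where
  "blocks G =
     {B. pre_digraph.max_subgraph G
           (\<lambda>H. graph H \<and> Digraph_Component.connected H \<and> \<not> (\<exists>v. cutvertex H v)) B}"

subsection \<open>Complete multipartite graphs\<close>

definition complete_multipartition :: "('a, 'b) pre_digraph \<Rightarrow> 'a set set \<Rightarrow> bool" where
  "complete_multipartition G P \<longleftrightarrow>
     partition_on (verts G) P \<and>
     (\<forall>u \<in> verts G. \<forall>v \<in> verts G. u \<rightarrow>\<^bsub>G\<^esub> v \<longleftrightarrow> \<not> (\<exists>C \<in> P. u \<in> C \<and> v \<in> C))"

definition complete_multipartite :: "('a, 'b) pre_digraph \<Rightarrow> bool" where
  "complete_multipartite G \<longleftrightarrow> graph G \<and> (\<exists>P. complete_multipartition G P)"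

text \<open>
  For a complete multipartite graph both descriptions below are unique, see
  \<open>partite_classes_eq\<close> and \<open>partite_class_eq\<close>.
\<close>

definition partite_classes :: "('a, 'b) pre_digraph \<Rightarrow> 'a set set" where
  "partite_classes G = (THE P. complete_multipartition G P)"

definition partite_class :: "('a, 'b) pre_digraph \<Rightarrow> 'a \<Rightarrow> 'a set" where
  "partite_class G x = (THE C. C \<in> partite_classes G \<and> x \<in> C)"

lemma complete_multipartition_classes:
  assumes "complete_multipartition G P"
  shows "P = (\<lambda>u. {v \<in> verts G. \<not> (u \<rightarrow>\<^bsub>G\<^esub> v)}) ` verts G"
proof -
  have part: "partition_on (verts G) P"
    and adj: "\<And>u v. u \<in> verts G \<Longrightarrow> v \<in> verts G \<Longrightarrow>
      u \<rightarrow>\<^bsub>G\<^esub> v \<longleftrightarrow> \<not> (\<exists>C \<in> P. u \<in> C \<and> v \<in> C)"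
    using assms by (auto simp: complete_multipartition_def)
  have sub: "C \<subseteq> verts G" if "C \<in> P" for C
    using part that by (auto simp: partition_on_def)
  have class_eq: "C = {v \<in> verts G. \<not> (u \<rightarrow>\<^bsub>G\<^esub> v)}" if "C \<in> P" "u \<in> C" for C u
  proof -
    have uniq: "D = C" if "D \<in> P" "u \<in> D" for D
      using part that \<open>C \<in> P\<close> \<open>u \<in> C\<close> by (auto simp: partition_on_def disjoint_def)
    have "u \<in> verts G"
      using sub that by auto
    then have "v \<in> C \<longleftrightarrow> v \<in> verts G \<and> \<not> (u \<rightarrow>\<^bsub>G\<^esub> v)" for v
      using adj[of u v] uniq sub[OF \<open>C \<in> P\<close>] that by (metis subsetD)
    then show ?thesis
      by (intro set_eqI) simp
  qed
  show ?thesis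
  proof (intro equalityI subsetI)
    fix C assume C: "C \<in> P"
    moreover have "C \<noteq> {}"
      using part C by (auto simp: partition_on_def)
    ultimately obtain u where "u \<in> C" "u \<in> verts G"
      using sub[OF C] by auto
    then show "C \<in> (\<lambda>u. {v \<in> verts G. \<not> (u \<rightarrow>\<^bsub>G\<^esub> v)}) ` verts G"
      using class_eq[OF C] by (intro image_eqI[of _ _ u])
  next
    fix C assume "C \<in> (\<lambda>u. {v \<in> verts G. \<not> (u \<rightarrow>\<^bsub>G\<^esub> v)}) ` verts G"
    then obtain u where u: "u \<in> verts G" "C = {v \<in> verts G. \<not> (u \<rightarrow>\<^bsub>G\<^esub> v)}"
      by blast
    moreover obtain D where "D \<in> P" "u \<in> D"
      using part u(1) by (auto simp: partition_on_def)
    ultimately show "C \<in> P"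
      using class_eq by simp
  qed
qed

lemma partite_classes_eq:
  assumes "complete_multipartition G P"
  shows "partite_classes G = P"
  unfolding partite_classes_def
proof (rule the_equality)
  show "complete_multipartition G P"
    by (fact assms)
  show "Q = P" if "complete_multipartition G Q" for Q
    unfolding complete_multipartition_classes[OF that] complete_multipartition_classes[OF assms] ..
qed

lemma partite_class_eq:
  assumes "complete_multipartition G P" "C \<in> P" "x \<in> C"
  shows "partite_class G x = C"
proof -
  have "partition_on (verts G) P"
    using assms(1) by (simp add: complete_multipartition_def)
  then show ?thesis
    unfolding partite_class_def partite_classes_eq[OF assms(1)]
    using assms(2,3) by (intro the_equality) (auto simp: partition_on_def disjoint_def)
qed

subsection \<open>Multipartite block fans\<close>

definition block_complete_multipartite :: "('a, 'b) pre_digraph \<Rightarrow> bool" where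
  "block_complete_multipartite G \<longleftrightarrow>
     graph G \<and> Digraph_Component.connected G \<and> (\<forall>B \<in> blocks G. complete_multipartite B)"

definition multipartite_block_fan :: "('a, 'b) pre_digraph \<Rightarrow> 'a \<Rightarrow> bool" where
  "multipartite_block_fan G x \<longleftrightarrow>
     block_complete_multipartite G \<and>
     cutvertex G x \<and>
     (\<forall>B \<in> blocks G. x \<in> verts B) \<and>
     (\<forall>B \<in> blocks G. \<forall>B' \<in> blocks G. B \<noteq> B' \<longrightarrow> verts B \<inter> verts B' = {x})"

definition rho :: "('a, 'b) pre_digraph \<Rightarrow> 'a \<Rightarrow> nat" where
  "rho G x =
     card {B \<in> blocks G. 3 \<le> card (partite_classes B) \<and> 2 \<le> card (partite_class B x)}"

lemma finite_blocks:
  assumes "graph G"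
  shows "finite (blocks G)"
proof -
  interpret graph G by fact
  let ?sub = "\<lambda>(V, A). \<lparr>verts = V, arcs = A, tail = tail G, head = head G\<rparr>"
  have "B \<in> ?sub ` (Pow (verts G) \<times> Pow (arcs G))" if "B \<in> blocks G" for B
  proof (rule image_eqI)
    have B: "subgraph B G"
      using that by (simp add: blocks_def max_subgraph_def)
    show "B = ?sub (verts B, arcs B)"
      using B by (simp add: subgraph_def compatible_def)
    show "(verts B, arcs B) \<in> Pow (verts G) \<times> Pow (arcs G)"
      using B by (simp add: subgraph_def)
  qed
  then have "blocks G \<subseteq> ?sub ` (Pow (verts G) \<times> Pow (arcs G))"
    by blast
  then show ?thesis
    by (rule finite_subset) simp
qed

end

theory Submission
  imports Defs
begin

text \<open>
  Removing the leaves of a tree turns an exact 6-leaf power into a placement of the vertices of the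
  graph on the vertices of a tree in which adjacency means distance 4. Three vertices that are
  pairwise at distance 4 have a common centre at distance 2, so a block with at least three partite
  classes surrounds a hub, and its classes are the branches at that hub. Call such a block special if
  the class of \<open>x\<close> contains a further vertex, a twin \<open>y\<close> of \<open>x\<close> within the block. The twin lies in
  the branch of \<open>x\<close> but, since \<open>x\<close> has neighbours in other blocks, not at the same place; hence it is
  at distance 2 from \<open>x\<close>.

  If there are two special blocks, their twins are not adjacent, so they are not at distance 4 and
  all of \<open>x\<close> and the twins are neighbours of one vertex. A twin must not be adjacent to the
  vertices around the hub of the other special block. The only way to avoid this is to sit on that
  hub itself. With three special blocks, the twins of two of them would have to sit together on the
  hub of the third. But the second twin also sits on the hub of the first block, and the first twin
  is at distance 2 from there. This proves \<open>rho G x \<le> 2\<close>. The formal argument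
  (\<open>exact_leaf_power_imp_rho_le\<close>) only uses distances between leaves: the four-point condition,
  parity, and the fact that a detour through a leaf wastes two edges. The lemmas \<open>twin_distance\<close>,
  \<open>twin_of_other_triangle\<close> and \<open>no_two_twins_at_triangle\<close> carry it.

  Conversely, two special blocks can exchange their hubs: the hubs are two neighbours of one neighbour
  of \<open>x\<close>, and the twins of each block are placed on the hub of the other. All other blocks live on
  separate arms at \<open>x\<close>. If the class of \<open>x\<close> is \<open>{x}\<close>, the block surrounds a hub on its arm. If the
  block is bipartite, its arm is a path with the opposite class at distance 4 and the rest of the class
  of \<open>x\<close> at distance 8. Vertices on different arms are never at distance 4
  (\<open>place_adjacent\<close>).

  The link between trees and arithmetic is a system of coordinates: every vertex of a rooted tree
  has a list as its address, and distances are computed from common prefixes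
  (\<open>undirected_tree_imp_trie_coords\<close>, \<open>trie_coords_mu\<close>).
\<close>


section \<open>The tree of all lists\<close>

fun lcp_length :: "'c list \<Rightarrow> 'c list \<Rightarrow> nat" where
  "lcp_length (a # as) (b # bs) = (if a = b then Suc (lcp_length as bs) else 0)"
| "lcp_length [] bs = 0"
| "lcp_length as [] = 0"

text \<open>
  Lists form an infinite tree rooted at \<open>[]\<close> in which every list is joined to its one-element
  extensions. The path between two lists climbs to their longest common prefix and descends again;
  its length is the distance below. A list thus serves as the address of a vertex in a rooted tree.
\<close>

definition prefix_dist :: "'c list \<Rightarrow> 'c list \<Rightarrow> nat" where
  "prefix_dist xs ys = (length xs - lcp_length xs ys) + (length ys - lcp_length xs ys)"

lemma lcp_le: "lcp_length xs ys \<le> length xs" "lcp_length xs ys \<le> length ys"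
  by (induction xs ys rule: lcp_length.induct) auto

lemma lcp_commute: "lcp_length xs ys = lcp_length ys xs"
  by (induction xs ys rule: lcp_length.induct) (auto, metis lcp_length.elims list.discI)

lemma lcp_Nil [simp]: "lcp_length xs [] = 0"
  using lcp_le(2)[of xs "[]"] by simp

lemma prefix_dist_Cons [simp]:
  "prefix_dist (a # as) (b # bs) = (if a = b then prefix_dist as bs else length as + length bs + 2)"
  by (simp add: prefix_dist_def)

lemma prefix_dist_Nil [simp]: "prefix_dist [] ys = length ys" "prefix_dist xs [] = length xs"
  by (simp_all add: prefix_dist_def)

lemma prefix_dist_commute: "prefix_dist xs ys = prefix_dist ys xs"
  by (simp add: prefix_dist_def lcp_commute)

text \<open>
  Two lists that both agree with \<open>ys\<close> up to some length agree with each other up to that length. All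
  metric properties below are arithmetic consequences of this ultrametric inequality.
\<close>

lemma lcp_ultrametric: "min (lcp_length xs ys) (lcp_length ys zs) \<le> lcp_length xs zs"
proof (induction xs ys arbitrary: zs rule: lcp_length.induct)
  case (1 a as b bs)
  then show ?case by (cases zs) auto
qed auto

lemma prefix_dist_lcp: "prefix_dist xs ys + 2 * lcp_length xs ys = length xs + length ys"
  using lcp_le[of xs ys] by (simp add: prefix_dist_def)

lemma prefix_dist_triangle: "prefix_dist xs zs \<le> prefix_dist xs ys + prefix_dist ys zs"
  using prefix_dist_lcp[of xs ys] prefix_dist_lcp[of ys zs] prefix_dist_lcp[of xs zs] lcp_ultrametric[of xs ys zs]
    lcp_le[of xs ys] lcp_le[of ys zs]
  by (auto simp: min_def split: if_splits)

text \<open>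
  Trees are bipartite: modulo 2 a distance is the sum of the two depths, and each depth occurs
  twice around a triangle.
\<close>

lemma prefix_dist_triangle_even: "even (prefix_dist xs ys + prefix_dist ys zs + prefix_dist xs zs)"
proof -
  have "prefix_dist xs ys + prefix_dist ys zs + prefix_dist xs zs
      + 2 * (lcp_length xs ys + lcp_length ys zs + lcp_length xs zs)
      = 2 * (length xs + length ys + length zs)"
    using prefix_dist_lcp[of xs ys] prefix_dist_lcp[of ys zs] prefix_dist_lcp[of xs zs] by simp
  then show ?thesis
    by (metis dvd_triv_left even_add)
qed

text \<open>
  Four instances of the ultrametric inequality compare the common prefixes of the three pairings; the
  depths cancel because each of the four lists occurs once in every sum.
\<close>

lemma prefix_dist_four_point:
  "prefix_dist a b + prefix_dist c d \<le>
    max (prefix_dist a c + prefix_dist b d) (prefix_dist a d + prefix_dist b c)"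
proof -
  have "min (lcp_length a c + lcp_length b d) (lcp_length a d + lcp_length b c) \<le> lcp_length a b + lcp_length c d"
    using lcp_ultrametric[of a c b] lcp_ultrametric[of a d b] lcp_ultrametric[of c a d]
      lcp_ultrametric[of c b d] lcp_commute[of b c] lcp_commute[of b d] lcp_commute[of a c]
      lcp_commute[of a d] 
    by linarith
  then show ?thesis
    using prefix_dist_lcp[of a b] prefix_dist_lcp[of c d] prefix_dist_lcp[of a c] prefix_dist_lcp[of b d]
      prefix_dist_lcp[of a d] prefix_dist_lcp[of b c]
    by linarith
qed

lemma lcp_snoc: "lcp_length (xs @ [a]) ys = lcp_length xs ys +
    (if lcp_length xs ys = length xs \<and> length xs < length ys \<and> ys ! length xs = a then 1 else 0)"
proof (induction xs ys rule: lcp_length.induct)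
  case (2 bs)
  then show ?case by (cases bs) auto
qed auto

lemma prefix_dist_snoc:
  "prefix_dist (xs @ [a]) ys =
    (if lcp_length xs ys = length xs \<and> length xs < length ys \<and> ys ! length xs = a
     then prefix_dist xs ys - 1 else prefix_dist xs ys + 1)"
  using lcp_le[of xs ys] by (auto simp: prefix_dist_def lcp_snoc)

lemma lcp_eq_length_take: "lcp_length xs ys = length xs \<Longrightarrow> take (length xs) ys = xs"
  by (induction xs ys rule: lcp_length.induct) (auto split: if_splits)

lemma prefix_dist_eq_0 [simp]: "prefix_dist xs ys = 0 \<longleftrightarrow> xs = ys"
proof
  assume "prefix_dist xs ys = 0"
  then have "lcp_length xs ys = length xs" "length ys = length xs"
    using lcp_le[of xs ys] by (auto simp: prefix_dist_def)
  then show "xs = ys"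
    using lcp_eq_length_take by fastforce
next
  have "lcp_length ys ys = length ys" by (induction ys) auto
  then show "prefix_dist xs ys = 0" if "xs = ys" by (simp add: prefix_dist_def that)
qed

lemma prefix_dist_same [simp]: "prefix_dist xs xs = 0"
  by simp

section \<open>Coordinates of trees\<close>

text \<open>
  Coordinates place the vertices of \<open>T\<close> injectively on a prefix-closed set of lists so that adjacency
  becomes one-step extension. They turn statements about walks and cycles into computations with
  lists, and among finite nonempty graphs they exist exactly for trees. Both directions of the theorem
  pass through them: a given tree receives coordinates, and a new tree is defined by its coordinates.
\<close>

definition trie_coords :: "('a, 'b) pre_digraph \<Rightarrow> ('a \<Rightarrow> 'c list) \<Rightarrow> bool" where
  "trie_coords T \<phi> \<longleftrightarrow>
     inj_on \<phi> (verts T) \<and>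
     (\<forall>xs a. xs @ [a] \<in> \<phi> ` verts T \<longrightarrow> xs \<in> \<phi> ` verts T) \<and>
     (\<forall>u \<in> verts T. \<forall>v \<in> verts T.
        u \<rightarrow>\<^bsub>T\<^esub> v \<longleftrightarrow> (\<exists>a. \<phi> v = \<phi> u @ [a] \<or> \<phi> u = \<phi> v @ [a]))"

lemma trie_coordsD:
  assumes "trie_coords T \<phi>"
  shows "u \<in> verts T \<Longrightarrow> v \<in> verts T \<Longrightarrow> \<phi> u = \<phi> v \<Longrightarrow> u = v"
    and "xs @ [a] \<in> \<phi> ` verts T \<Longrightarrow> xs \<in> \<phi> ` verts T"
    and "u \<in> verts T \<Longrightarrow> v \<in> verts T \<Longrightarrow>
      (u \<rightarrow>\<^bsub>T\<^esub> v) = (\<exists>a. \<phi> v = \<phi> u @ [a] \<or> \<phi> u = \<phi> v @ [a])"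
  using assms unfolding trie_coords_def inj_on_def by blast+

lemma trie_coords_take:
  assumes "trie_coords T \<phi>" "xs \<in> \<phi> ` verts T"
  shows "take n xs \<in> \<phi> ` verts T"
  using assms(2)
proof (induction xs rule: rev_induct)
  case (snoc a xs)
  then show ?case
    using trie_coordsD(2)[OF assms(1)] by (cases "n \<le> length xs") auto
qed simp

context wf_digraph
begin

lemma trie_coords_adj:
  assumes "trie_coords G \<phi>" "u \<rightarrow> v"
  shows "\<exists>a. \<phi> v = \<phi> u @ [a] \<or> \<phi> u = \<phi> v @ [a]"
  using trie_coordsD(3)[OF assms(1) adj_in_verts[OF assms(2)]] assms(2) by simp

text \<open>
  A neighbour nearer to \<open>v\<close> always exists inside the graph: below \<open>u\<close> if the address of \<open>u\<close> is a
  prefix of that of \<open>v\<close>, otherwise above \<open>u\<close>. Prefix-closedness provides the vertex in both cases.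
\<close>

lemma trie_coords_step:
  assumes "trie_coords G \<phi>" "u \<in> verts G" "v \<in> verts G" "u \<noteq> v"
  shows "\<exists>w. (u \<rightarrow> w) \<and> prefix_dist (\<phi> u) (\<phi> v) = Suc (prefix_dist (\<phi> w) (\<phi> v))"
proof -
  have ne: "\<phi> u \<noteq> \<phi> v" using assms trie_coordsD(1)[OF assms(1)] by blast
  show ?thesis
  proof (cases "lcp_length (\<phi> u) (\<phi> v) = length (\<phi> u)")
    case True
    then have len: "length (\<phi> u) < length (\<phi> v)"
      using ne lcp_eq_length_take[OF True] lcp_le(2)[of "\<phi> u" "\<phi> v"]
      by (metis le_neq_implies_less take_all order_refl)
    have "take (Suc (length (\<phi> u))) (\<phi> v) = \<phi> u @ [\<phi> v ! length (\<phi> u)]"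
      using lcp_eq_length_take[OF True] len by (simp add: take_Suc_conv_app_nth)
    then obtain w where w: "w \<in> verts G" "\<phi> w = \<phi> u @ [\<phi> v ! length (\<phi> u)]"
      using trie_coords_take[OF assms(1), of "\<phi> v" "Suc (length (\<phi> u))"] assms(3) by auto
    have "u \<rightarrow> w" using trie_coordsD(3)[OF assms(1,2) w(1)] w(2) by simp
    moreover have "prefix_dist (\<phi> u) (\<phi> v) = Suc (prefix_dist (\<phi> w) (\<phi> v))"
      using True len ne prefix_dist_eq_0[of "\<phi> u" "\<phi> v"] by (simp add: w(2) prefix_dist_snoc del: prefix_dist_eq_0)
    ultimately show ?thesis by blast
  next
    case False
    then have "\<phi> u \<noteq> []" by auto
    then obtain xs a where xs: "\<phi> u = xs @ [a]" by (metis rev_exhaust)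
    then obtain w where w: "w \<in> verts G" "\<phi> w = xs"
      using trie_coordsD(2)[OF assms(1), of xs a] assms(2) by (metis imageE imageI)
    have "u \<rightarrow> w" using trie_coordsD(3)[OF assms(1,2) w(1)] w(2) xs by simp
    moreover have "prefix_dist (\<phi> u) (\<phi> v) = Suc (prefix_dist (\<phi> w) (\<phi> v))"
      using False unfolding xs w(2) by (auto simp: prefix_dist_snoc lcp_snoc)
    ultimately show ?thesis by blast
  qed
qed

lemma trie_coords_walk:
  assumes "trie_coords G \<phi>" "u \<in> verts G" "v \<in> verts G"
  shows "\<exists>p. awalk u p v \<and> length p = prefix_dist (\<phi> u) (\<phi> v)"
  using assms(2)
proof (induction "prefix_dist (\<phi> u) (\<phi> v)" arbitrary: u)
  case 0
  then have "u = v" using trie_coordsD(1)[OF assms(1) _ assms(3)] by simp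
  then show ?case using 0 by (intro exI[of _ "[]"]) (simp add: awalk_Nil_iff)
next
  case (Suc n)
  then have "u \<noteq> v" by auto
  then obtain w where w: "u \<rightarrow> w" "prefix_dist (\<phi> u) (\<phi> v) = Suc (prefix_dist (\<phi> w) (\<phi> v))"
    using trie_coords_step assms Suc by blast
  then obtain p where p: "awalk w p v" "length p = prefix_dist (\<phi> w) (\<phi> v)"
    using Suc adj_in_verts(2)[OF w(1)] by auto
  obtain e where "e \<in> arcs G" "tail G e = u" "head G e = w" using w(1) by auto
  then have "awalk u (e # p) v \<and> length (e # p) = prefix_dist (\<phi> u) (\<phi> v)"
    using p w by (auto simp: awalk_Cons_iff)
  then show ?case by blast
qed

text \<open>
  One step changes the list distance by one only, so no walk is shorter than that distance.
\<close>

lemma trie_coords_walk_length: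
  assumes "trie_coords G \<phi>" "awalk u p v"
  shows "prefix_dist (\<phi> u) (\<phi> v) \<le> length p"
  using assms(2)
proof (induction p arbitrary: u)
  case (Cons e p)
  have e: "e \<in> arcs G" "tail G e = u" "awalk (head G e) p v"
    using Cons.prems by (auto simp: awalk_Cons_iff)
  have "tail G e \<rightarrow> head G e" using e by (auto simp: arcs_ends_conv)
  then obtain a where "\<phi> (head G e) = \<phi> u @ [a] \<or> \<phi> u = \<phi> (head G e) @ [a]"
    using trie_coords_adj[OF assms(1)] e(2) by blast
  then have "prefix_dist (\<phi> u) (\<phi> v) \<le> Suc (prefix_dist (\<phi> (head G e)) (\<phi> v))"
    by (auto simp: prefix_dist_snoc)
  then show ?case using Cons.IH[OF e(3)] by simp
qed (simp add: awalk_Nil_iff)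

lemma awalk_cost_unit: "awalk_cost (\<lambda>_. 1) p = real (length p)"
  by (induction p) auto

lemma trie_coords_mu:
  assumes "trie_coords G \<phi>" "u \<in> verts G" "v \<in> verts G"
  shows "\<mu> (\<lambda>_. 1) u v = ereal (real (prefix_dist (\<phi> u) (\<phi> v)))"
proof (rule antisym)
  obtain p where "awalk u p v" "length p = prefix_dist (\<phi> u) (\<phi> v)"
    using trie_coords_walk[OF assms] by blast
  then show "\<mu> (\<lambda>_. 1) u v \<le> ereal (real (prefix_dist (\<phi> u) (\<phi> v)))"
    using min_cost_le_walk_cost[of u p v "\<lambda>_. 1"] by (simp add: awalk_cost_unit)
  show "ereal (real (prefix_dist (\<phi> u) (\<phi> v))) \<le> \<mu> (\<lambda>_. 1) u v"
    unfolding \<mu>_def using trie_coords_walk_length[OF assms(1)]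
    by (auto intro!: INF_greatest simp: awalk_cost_unit)
qed

lemma trie_coords_strongly_connected:
  assumes "trie_coords G \<phi>" "verts G \<noteq> {}"
  shows "strongly_connected G"
  using trie_coords_walk[OF assms(1)] assms(2)
  by (intro strongly_connectedI) (auto simp: reachable_awalk)

end


lemma (in wf_digraph) tl_awalk_verts: 
  assumes "cas u p v" shows "tl (awalk_verts u p) = map (head G) p"
  using assms
proof (induction p arbitrary: u)
  case (Cons e p)
  then show ?case by (cases p) auto
qed simp

lemma (in wf_digraph) trie_coords_parent:
  assumes "trie_coords G \<phi>" "x \<rightarrow> y \<or> y \<rightarrow> x" "length (\<phi> x) \<le> length (\<phi> y)"
  shows "\<phi> x = butlast (\<phi> y)"
proof -
  have "x \<in> verts G" "y \<in> verts G" using assms(2) adj_in_verts by auto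
  then obtain a where "\<phi> y = \<phi> x @ [a] \<or> \<phi> x = \<phi> y @ [a]"
    using assms(2) trie_coords_adj[OF assms(1)] by metis
  then show ?thesis using assms(3) by auto
qed

text \<open>
  A deepest vertex of a cycle has both its neighbours on the cycle at smaller depth, hence equal to
  its only parent; on a cycle of length at least three the two neighbours are distinct.
\<close>

lemma (in wf_digraph) trie_coords_acyclic:
  assumes \<phi>: "trie_coords G \<phi>" and p: "cycle p" "3 \<le> length p"
  shows False
proof -
  obtain u where u: "awalk u p u" "distinct (tl (awalk_verts u p))" "p \<noteq> []"
    using p(1)[unfolded cycle_def] by (elim exE conjE)
  then have heads: "distinct (map (head G) p)"
    using tl_awalk_verts[of u p u] by (simp add: awalk_def)
  define m where "m f = length (\<phi> (tail G f))" for f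
  have "Max (m ` set p) \<in> m ` set p"
    using u(3) by (intro Max_in) auto
  then obtain e where e: "e \<in> set p" "m e = Max (m ` set p)"
    by (auto simp only: image_iff)
  have emax: "length (\<phi> (tail G f)) \<le> length (\<phi> (tail G e))" if "f \<in> set p" for f
    using Max_ge[of "m ` set p" "m f"] that e(2) unfolding m_def[symmetric] by simp
  obtain q r where qr: "p = q @ e # r" using e(1) by (meson split_list)
  \<comment> \<open>Rotate the cycle so that it starts at the deepest vertex, the tail of \<open>e\<close>.\<close>
  define p' where "p' = e # r @ q"
  have "awalk u q (tail G e)" "awalk (tail G e) (e # r) u"
    using u(1) unfolding qr by (auto simp: awalk_Cons_iff)
  then have w: "awalk (tail G e) p' (tail G e)"
    unfolding p'_def using awalk_appendI[of "tail G e" "e # r" u q "tail G e"] by simp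
  have "3 \<le> length p'" using p(2) unfolding p'_def qr by simp
  then have len: "length (r @ q) \<ge> 2" by (simp add: p'_def)
  then have "2 \<le> length (rev (r @ q))"
    by simp
  then obtain f g s' where "rev (r @ q) = f # g # s'"
    by (metis Suc_le_length_iff numeral_2_eq_2)
  then have "r @ q = rev (f # g # s')"
    by (metis rev_rev_ident)
  then obtain s where s: "r @ q = s @ [g, f]"
    by simp
  have set_p: "set p = insert e (set s \<union> {g, f})"
  proof -
    have "set p = insert e (set (r @ q))" unfolding qr by auto
    then show ?thesis unfolding s by auto
  qed
  have "distinct (map (head G) (r @ q))" "head G e \<notin> set (map (head G) (r @ q))"
    using heads unfolding qr by auto
  then have dist: "head G e \<noteq> head G g"
    unfolding s by auto
  have arcs: "e \<in> arcs G" "f \<in> arcs G" "head G f = tail G e" "tail G f = head G g"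
    using w unfolding p'_def s by (simp_all add: awalk_Cons_iff awalk_Nil_iff)
  have "tail G f \<rightarrow> tail G e" using in_arcs_imp_in_arcs_ends[OF arcs(2)] arcs(3) by simp
  moreover have "f \<in> set p" using set_p by simp
  ultimately have 1: "\<phi> (tail G f) = butlast (\<phi> (tail G e))"
    using trie_coords_parent[OF \<phi>] emax by blast
  obtain h t where ht: "s @ [g, f] = h # t" by (cases "s @ [g, f]") auto
  have "tail G h = head G e" using w unfolding p'_def s ht by (simp add: awalk_Cons_iff)
  moreover have "h \<in> set p"
    using list.set_intros(1)[of h t] set_p unfolding ht[symmetric] by auto
  ultimately have "length (\<phi> (head G e)) \<le> length (\<phi> (tail G e))"
    using emax by metis
  moreover have "tail G e \<rightarrow> head G e" using in_arcs_imp_in_arcs_ends[OF arcs(1)] by simp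
  ultimately have 2: "\<phi> (head G e) = butlast (\<phi> (tail G e))"
    using trie_coords_parent[OF \<phi>] by blast
  have "tail G f = head G e"
    using trie_coordsD(1)[OF \<phi>, of "tail G f" "head G e"] arcs(1,2) 1 2
    by simp
  then show False using dist arcs(4) by simp
qed


text \<open>
  If \<open>v\<close> had two neighbours in the connected set \<open>S\<close>, a path between them inside \<open>S\<close> would close up
  to a cycle through \<open>v\<close>. This is what lets coordinates grow one vertex at a time.
\<close>

lemma (in wf_digraph) no_second_neighbour:
  assumes acyclic: "\<And>p. cycle p \<Longrightarrow> length p < 3"
    and S: "S \<subseteq> verts G" "strongly_connected (G \<restriction> S)"
    and qw: "q \<in> S" "w \<in> S" and v: "v \<notin> S" "q \<rightarrow> v" "v \<rightarrow> w"
  shows "w = q"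
proof (rule ccontr)
  assume "w \<noteq> q"
  interpret GS: wf_digraph "G \<restriction> S" by auto
  have "w \<rightarrow>\<^sup>*\<^bsub>G \<restriction> S\<^esub> q"
    using S(2) qw by (auto simp: strongly_connected_def)
  then obtain p where p': "GS.apath w p q"
    by (auto simp: GS.reachable_apath)
  have sub: "subgraph (G \<restriction> S) G"
    using S(1) by (rule subgraph_induce_subgraphI)
  have p: "apath w p q"
    using p' sub by (rule subgraph_apath_imp_apath)
  have pS: "set (awalk_verts w p) \<subseteq> S"
    using p' GS.awalk_verts_in_verts[of w p] unfolding GS.apath_def GS.awalk_def
    by (auto simp: awalk_verts_induce)
  obtain e1 where e1: "e1 \<in> arcs G" "tail G e1 = q" "head G e1 = v" using v(2) by auto
  obtain e2 where e2: "e2 \<in> arcs G" "tail G e2 = v" "head G e2 = w" using v(3) by auto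
  let ?c = "e2 # p @ [e1]"
  have aw: "awalk w p q" and d: "distinct (awalk_verts w p)" using p by (auto simp: apath_def)
  have "awalk q [e1] v"
    using e1 by (auto simp: awalk_Cons_iff awalk_Nil_iff)
  then have "awalk w (p @ [e1]) v"
    using aw by (rule awalk_appendI[rotated])
  then have c: "awalk v ?c v"
    using e2 by (auto simp: awalk_Cons_iff)
  have "tl (awalk_verts v ?c) = map (head G) ?c"
    using c by (intro tl_awalk_verts) (simp add: awalk_def)
  also have "\<dots> = awalk_verts w p @ [v]"
    using tl_awalk_verts[of w p q] aw e1 e2 
    by (cases p) (auto simp: awalk_def)
  finally have "cycle ?c"
    unfolding cycle_def using c d pS v(1) by (intro exI[of _ v]) auto
  moreover have "p \<noteq> []" using aw \<open>w \<noteq> q\<close> by (auto simp: awalk_Nil_iff)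
  then have "3 \<le> length ?c" by (cases p) auto
  ultimately show False using acyclic[of ?c] by simp
qed

text \<open>
  The new vertex becomes a child of its neighbour \<open>q\<close>. Its own name is the new list entry; since the
  addresses used so far only mention vertices of \<open>S\<close>, the new address is fresh.
\<close>

lemma (in graph) extend_trie_coords:
  assumes acyclic: "\<And>p. cycle p \<Longrightarrow> length p < 3"
    and S: "S \<subseteq> verts G" "trie_coords (G \<restriction> S) \<phi>" "\<And>u. u \<in> S \<Longrightarrow> set (\<phi> u) \<subseteq> S"
    and q: "q \<in> S" "v \<notin> S" "q \<rightarrow> v"
  shows "trie_coords (G \<restriction> insert v S) (\<phi>(v := \<phi> q @ [v]))"
proof -
  interpret GS: wf_digraph "G \<restriction> S" by auto
  have dom: "a \<rightarrow>\<^bsub>G \<restriction> X\<^esub> b \<longleftrightarrow> a \<rightarrow> b" if "a \<in> X" "b \<in> X" for a b X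
    using that by (auto simp: arcs_ends_conv)
  have sc: "strongly_connected (G \<restriction> S)"
    using GS.trie_coords_strongly_connected[OF S(2)] q(1) by auto
  have only: "w \<in> S \<Longrightarrow> v \<rightarrow> w \<longleftrightarrow> w = q" for w
    using no_second_neighbour[OF acyclic S(1) sc q(1) _ q(2,3)] q(3) graph_symmetric by blast
  have inj: "inj_on \<phi> S" and pre: "\<And>xs a. xs @ [a] \<in> \<phi> ` S \<Longrightarrow> xs \<in> \<phi> ` S"
    and adj: "\<And>a b. a \<in> S \<Longrightarrow> b \<in> S \<Longrightarrow> a \<rightarrow> b \<longleftrightarrow> (\<exists>c. \<phi> b = \<phi> a @ [c] \<or> \<phi> a = \<phi> b @ [c])"
    using S(2) by (auto simp: trie_coords_def dom)
  have fresh: "\<phi> q @ [v] @ xs \<noteq> \<phi> u" if "u \<in> S" for u xs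
    using S(3)[OF that] q(2) by (metis append_Cons in_set_conv_decomp subsetD)
  let ?\<psi> = "\<phi>(v := \<phi> q @ [v])"
  have vS: "u \<noteq> v" if "u \<in> S" for u using that q(2) by auto
  have "\<phi> q @ [v] \<notin> \<phi> ` S"
    using fresh[of _ "[]"] by auto
  then have "inj_on ?\<psi> (insert v S)"
    using inj q(2) by (simp add: inj_on_fun_updI) blast
  moreover have "xs \<in> ?\<psi> ` insert v S" if "xs @ [a] \<in> ?\<psi> ` insert v S" for xs a
  proof -
    have "xs @ [a] = \<phi> q @ [v] \<or> xs @ [a] \<in> \<phi> ` S" using that by (auto split: if_splits)
    then have "xs \<in> \<phi> ` S" using pre q(1) by auto
    then show ?thesis using vS by force
  qed
  moreover have "a \<rightarrow> b \<longleftrightarrow> (\<exists>c. ?\<psi> b = ?\<psi> a @ [c] \<or> ?\<psi> a = ?\<psi> b @ [c])"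
    if ab: "a \<in> insert v S" "b \<in> insert v S" for a b
  proof -
    have v_adj: "v \<rightarrow> w \<longleftrightarrow> (\<exists>c. ?\<psi> w = ?\<psi> v @ [c] \<or> ?\<psi> v = ?\<psi> w @ [c])" if "w \<in> S" for w
    proof -
      have "\<phi> w \<noteq> \<phi> q @ [v, c]" for c
        using fresh[OF that, of "[c]"] by simp
      then show ?thesis
        using only[OF that] inj_on_eq_iff[OF inj that q(1)] vS[OF that] by auto
    qed
    consider "a = v" "b = v" | "a = v" "b \<in> S" | "a \<in> S" "b = v" | "a \<in> S" "b \<in> S"
      using ab by auto
    then show ?thesis
    proof cases
      case 1
      then show ?thesis using adj_not_same[of v] by auto
    next
      case 2
      then show ?thesis using v_adj by simp
    next
      case 3
      then show ?thesis using v_adj[of a] graph_symmetric[of a v] graph_symmetric[of v a] by blast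
    next
      case 4
      then show ?thesis using adj[of a b] vS[of a] vS[of b] by simp
    qed
  qed
  ultimately show ?thesis
    unfolding trie_coords_def by (simp add: dom del: fun_upd_apply)
qed

lemma undirected_tree_imp_trie_coords:
  fixes T :: "('a, 'b) pre_digraph"
  assumes "undirected_tree T"
  shows "\<exists>\<phi> :: 'a \<Rightarrow> 'a list. trie_coords T \<phi>"
proof -
  interpret graph T using assms by (simp add: undirected_tree_def)
  have acyclic: "cycle p \<Longrightarrow> length p < 3" for p
    using assms by (auto simp: undirected_tree_def not_le)
  have sc: "strongly_connected T"
    using assms sym_arcs by (auto simp: undirected_tree_def intro: symmetric_connected_imp_strongly_connected)
  \<comment> \<open>Grow a connected induced subgraph with coordinates until it exhausts the tree.\<close>
  have "\<exists>S. S \<subseteq> verts T \<and> card S = Suc n \<and>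
      (\<exists>\<phi> :: 'a \<Rightarrow> 'a list. trie_coords (T \<restriction> S) \<phi> \<and> (\<forall>u \<in> S. set (\<phi> u) \<subseteq> S))"
    if "n < card (verts T)" for n
    using that
  proof (induction n)
    case 0
    obtain r where "r \<in> verts T" using sc by (auto simp: strongly_connected_def)
    moreover have "trie_coords (T \<restriction> {r}) (\<lambda>_. [])"
      using adj_not_same by (auto simp: trie_coords_def dest: dominates_induce_subgraphD)
    ultimately show ?case by (intro exI[of _ "{r}"]) auto
  next
    case (Suc n)
    then obtain S \<phi> where S: "S \<subseteq> verts T" "card S = Suc n"
      "trie_coords (T \<restriction> S) (\<phi> :: 'a \<Rightarrow> 'a list)" "\<And>u. u \<in> S \<Longrightarrow> set (\<phi> u) \<subseteq> S"
      by auto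
    have fin: "finite S" using S(1) finite_verts by (rule finite_subset)
    obtain r where r: "r \<in> S" using S(2) by (metis card_eq_SucD insertI1)
    obtain z where z: "z \<in> verts T" "z \<notin> S" using S Suc.prems by (metis less_irrefl subsetI subset_antisym)
    have "r \<rightarrow>\<^sup>*\<^bsub>T\<^esub> z" using sc r z S(1) by (auto simp: strongly_connected_def)
    then have "z \<notin> S \<longrightarrow> (\<exists>q v. q \<in> S \<and> v \<notin> S \<and> q \<rightarrow>\<^bsub>T\<^esub> v)"
      by (induction rule: reachable_induct) (use r in auto)
    then obtain q v where q: "q \<in> S" "v \<notin> S" "q \<rightarrow>\<^bsub>T\<^esub> v" using z by auto
    have "trie_coords (T \<restriction> insert v S) (\<phi>(v := \<phi> q @ [v]))"
      using acyclic S(1,3,4) q by (rule extend_trie_coords)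
    moreover have "\<forall>u \<in> insert v S. set ((\<phi>(v := \<phi> q @ [v])) u) \<subseteq> insert v S"
      using S(4) q by auto
    moreover have "insert v S \<subseteq> verts T" "card (insert v S) = Suc (Suc n)"
      using S q fin adj_in_verts(2)[OF q(3)] by auto
    ultimately show ?case by blast
  qed
  from this[of "card (verts T) - 1"] obtain S and \<phi> :: "'a \<Rightarrow> 'a list" where
    S: "S \<subseteq> verts T" "card S = card (verts T)" "trie_coords (T \<restriction> S) \<phi>"
    using sc by (auto simp: strongly_connected_def card_gt_0_iff)
  have "S = verts T" using S(1,2) finite_verts by (simp add: card_subset_eq)
  moreover have "a \<rightarrow>\<^bsub>T \<restriction> verts T\<^esub> b \<longleftrightarrow> a \<rightarrow>\<^bsub>T\<^esub> b" for a b
    by (auto simp: arcs_ends_conv)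
  ultimately show ?thesis using S(3) by (intro exI[of _ \<phi>]) (simp add: trie_coords_def)
qed

lemma (in wf_digraph) leaf_neighbour:
  assumes "out_degree G v = 1"
  shows "\<exists>!q. v \<rightarrow> q"
proof -
  obtain e where e: "out_arcs G v = {e}"
    using assms by (auto simp: out_degree_def card_1_singleton_iff)
  then have "e \<in> arcs G" "tail G e = v"
    by (metis in_out_arcs_conv insertI1)+
  then have "v \<rightarrow> head G e"
    using in_arcs_imp_in_arcs_ends by metis
  moreover have "w = head G e" if "v \<rightarrow> w" for w
  proof -
    obtain f where "f \<in> arcs G" "tail G f = v" "head G f = w"
      using \<open>v \<rightarrow> w\<close> by (rule reachableE)
    then have "f \<in> out_arcs G v" by simp
    then show ?thesis using e \<open>head G f = w\<close> by simp
  qed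
  ultimately show ?thesis by blast
qed

text \<open>
  Every path that ends in a leaf uses the only edge at that leaf, so this edge is traversed twice on
  the detour from \<open>v\<close> to \<open>w\<close> through \<open>x\<close>.
\<close>

lemma (in wf_digraph) leaf_prefix_dist:
  assumes "trie_coords G \<phi>" "x \<in> verts G" "out_degree G x = 1"
    and "v \<in> verts G" "w \<in> verts G" "v \<noteq> x" "w \<noteq> x"
  shows "prefix_dist (\<phi> v) (\<phi> w) + 2 \<le> prefix_dist (\<phi> v) (\<phi> x) + prefix_dist (\<phi> x) (\<phi> w)"
proof -
  obtain q where q: "prefix_dist (\<phi> x) (\<phi> v) = Suc (prefix_dist (\<phi> q) (\<phi> v))"
      "prefix_dist (\<phi> x) (\<phi> w) = Suc (prefix_dist (\<phi> q) (\<phi> w))"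
    using trie_coords_step[OF assms(1,2,4)] trie_coords_step[OF assms(1,2,5)] assms(6,7)
      leaf_neighbour[OF assms(3)] by blast
  then show ?thesis
    using prefix_dist_triangle[of "\<phi> v" "\<phi> w" "\<phi> q"] by (simp add: prefix_dist_commute)
qed


section \<open>Distances between leaves\<close>

text \<open>
  The properties of the distances between leaves of a tree that the obstruction needs. The last one
  improves the triangle inequality by the two copies of the leaf edge.
\<close>

locale leaf_metric =
  fixes V :: "'v set" and d :: "'v \<Rightarrow> 'v \<Rightarrow> nat"
  assumes sym: "u \<in> V \<Longrightarrow> v \<in> V \<Longrightarrow> d u v = d v u"
    and pos: "u \<in> V \<Longrightarrow> v \<in> V \<Longrightarrow> u \<noteq> v \<Longrightarrow> 0 < d u v"
    and even_triangle: "u \<in> V \<Longrightarrow> v \<in> V \<Longrightarrow> w \<in> V \<Longrightarrow> even (d u v + d v w + d u w)"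
    and four_point: "u \<in> V \<Longrightarrow> v \<in> V \<Longrightarrow> w \<in> V \<Longrightarrow> z \<in> V \<Longrightarrow>
      d u v + d w z \<le> max (d u w + d v z) (d u z + d v w)"
    and leaf: "v \<in> V \<Longrightarrow> u \<in> V \<Longrightarrow> w \<in> V \<Longrightarrow> u \<noteq> v \<Longrightarrow> w \<noteq> v \<Longrightarrow>
      d u w + 2 \<le> d u v + d v w"
begin

text \<open>
  The four-point condition and parity leave only the distances 2 and 4 between \<open>x\<close> and its twin \<open>y\<close>.
  At distance 2 both leaves would hang at the same vertex, and then no third leaf such as \<open>z\<close> could be
  at distance 6 from only one of them.
\<close>

lemma twin_distance:
  assumes V: "x \<in> V" "y \<in> V" "u \<in> V" "w \<in> V" "z \<in> V"
    and ne: "x \<noteq> y" "z \<noteq> x" "z \<noteq> y"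
    and six: "d x u = 6" "d x w = 6" "d u w = 6" "d y u = 6" "d y w = 6" "d x z = 6"
    and not6: "d x y \<noteq> 6" "d y z \<noteq> 6"
  shows "d x y = 4"
proof -
  have "d x y \<le> 6"
    using four_point[of x y u w] V six by simp
  moreover have "even (d x y)"
    using even_triangle[of x y u] V six by simp
  moreover have "d x y \<noteq> 2"
  proof
    assume "d x y = 2"
    then have "d y z = 6"
      using leaf[of x y z] leaf[of y x z] sym[of x y] V ne six by simp
    then show False using not6 by simp
  qed
  moreover have "d x y \<noteq> 0"
    using pos[of x y] V ne by simp
  ultimately show ?thesis
    using not6(1) by presburger
qed

text \<open>
  Here \<open>u\<close>, \<open>w\<close> and \<open>y'\<close> come from one special block and \<open>y\<close> is the twin of \<open>x\<close> in another one. The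
  distances force \<open>y\<close> to hang at the vertex that is the centre of the triangle of \<open>x\<close>, \<open>u\<close> and \<open>w\<close>: it
  has distance 4 to both \<open>u\<close> and \<open>w\<close>, where a smaller distance to one of them would contradict
  \<open>d u w = 6\<close>.
\<close>

lemma twin_of_other_triangle:
  assumes V: "x \<in> V" "y \<in> V" "y' \<in> V" "u \<in> V" "w \<in> V"
    and ne: "x \<noteq> y" "x \<noteq> y'" "y \<noteq> u" "y \<noteq> w"
    and four: "d x y = 4" "d x y' = 4"
    and six: "d x u = 6" "d x w = 6" "d u w = 6" "d y' u = 6" "d y' w = 6"
    and not6: "d y y' \<noteq> 6" "d y u \<noteq> 6" "d y w \<noteq> 6"
  shows "d y y' = 4" "d y u = 4" "d y w = 4"
proof -
  have "d y y' \<le> 6" "even (d y y')"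
    using leaf[of x y y'] even_triangle[of x y y'] sym[of x y] V ne four by auto
  then have yy: "d y y' \<le> 4"
    using not6(1) by presburger
  have le: "d y v \<le> 4" "4 \<le> d y y'"
    if "v \<in> V" "d x v = 6" "d y' v = 6" "d y v \<noteq> 6" for v
  proof -
    have "d y v \<le> 6" "even (d y v)"
      using four_point[of x y' y v] even_triangle[of x y v] sym[of y y'] that V four yy by auto
    then show "d y v \<le> 4"
      using that(4) by presburger
    then show "4 \<le> d y y'"
      using four_point[of x y y' v] that V four by auto
  qed
  show "d y y' = 4"
    using le(2)[of u] yy V six not6 by simp
  have "d u w + 2 \<le> d y u + d y w"
    using leaf[of y u w] sym[of y u] V ne by auto
  then show "d y u = 4" "d y w = 4"
    using le(1)[of u] le(1)[of w] V six not6 by auto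
qed

text \<open>
  A leaf at distance 4 from both \<open>u\<close> and \<open>w\<close>, which are 6 apart, can only hang at the midpoint of their
  path. Two such leaves therefore have distance 2, not 4.
\<close>

lemma no_two_twins_at_triangle:
  assumes V: "y \<in> V" "y' \<in> V" "u \<in> V" "w \<in> V"
    and "d y y' = 4" "d y u = 4" "d y w = 4" "d y' u = 4" "d y' w = 4" "d u w = 6"
  shows False
  using four_point[of y y' u w] assms by simp

end

lemma exact_leaf_power_leaf_metric:
  assumes "exact_leaf_power k G"
  obtains d where "leaf_metric (verts G) d"
    and "\<And>u v. u \<in> verts G \<Longrightarrow> v \<in> verts G \<Longrightarrow> u \<noteq> v \<Longrightarrow> u \<rightarrow>\<^bsub>G\<^esub> v \<longleftrightarrow> d u v = k"
proof -
  obtain T :: "('a + nat) pair_pre_digraph" where T: "undirected_tree (with_proj T)"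
      "leaves (with_proj T) = Inl ` verts G"
    and adj: "\<And>u v. u \<in> verts G \<Longrightarrow> v \<in> verts G \<Longrightarrow> u \<noteq> v \<Longrightarrow>
      u \<rightarrow>\<^bsub>G\<^esub> v \<longleftrightarrow> wf_digraph.\<mu> (with_proj T) (\<lambda>_. 1) (Inl u) (Inl v) = ereal (real k)"
    using assms unfolding exact_leaf_power_def by blast
  interpret T: graph "with_proj T"
    using T(1) by (simp add: undirected_tree_def)
  obtain \<phi> :: "'a + nat \<Rightarrow> ('a + nat) list" where \<phi>: "trie_coords (with_proj T) \<phi>"
    using undirected_tree_imp_trie_coords[OF T(1)] by blast
  define d where "d u v = prefix_dist (\<phi> (Inl u)) (\<phi> (Inl v))" for u v
  have leaf: "Inl u \<in> verts (with_proj T)" "out_degree (with_proj T) (Inl u) = 1" if "u \<in> verts G" for u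
  proof -
    have "Inl u \<in> leaves (with_proj T)" using that T(2) by blast
    then show "Inl u \<in> verts (with_proj T)" "out_degree (with_proj T) (Inl u) = 1"
      by (simp_all add: leaves_def)
  qed
  have "leaf_metric (verts G) d"
  proof
    show "d u v = d v u" for u v by (simp add: d_def prefix_dist_commute)
    show "0 < d u v" if "u \<in> verts G" "v \<in> verts G" "u \<noteq> v" for u v
    proof -
      have "\<phi> (Inl u) \<noteq> \<phi> (Inl v)"
        using trie_coordsD(1)[OF \<phi> leaf(1) leaf(1)] that by blast
      then show ?thesis by (simp add: d_def zero_less_iff_neq_zero)
    qed
    show "even (d u v + d v w + d u w)" for u v w
      unfolding d_def by (rule prefix_dist_triangle_even)
    show "d u v + d w z \<le> max (d u w + d v z) (d u z + d v w)" for u v w z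
      unfolding d_def by (rule prefix_dist_four_point)
    show "d u w + 2 \<le> d u v + d v w"
      if "v \<in> verts G" "u \<in> verts G" "w \<in> verts G" "u \<noteq> v" "w \<noteq> v" for u v w
      unfolding d_def
      by (rule T.leaf_prefix_dist[OF \<phi> leaf leaf(1) leaf(1)]) (use that in auto)
  qed
  moreover have "u \<rightarrow>\<^bsub>G\<^esub> v \<longleftrightarrow> d u v = k" if "u \<in> verts G" "v \<in> verts G" "u \<noteq> v" for u v
    using adj[OF that] T.trie_coords_mu[OF \<phi> leaf(1) leaf(1), OF that(1,2)] by (simp add: d_def)
  ultimately show thesis using that by blast
qed


section \<open>Blocks of a multipartite block fan\<close>

lemma (in wf_digraph) sccs_verts_empty: "verts G = {} \<Longrightarrow> sccs_verts = {}"
proof -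
  assume "verts G = {}"
  then have "S = {}" if "S \<in> sccs_verts" for S
    using sccs_verts_subsets[OF that] by simp
  moreover have "{} \<notin> sccs_verts" by (simp add: sccs_verts_def)
  ultimately show ?thesis by blast
qed

lemma cutvertex_imp_two_verts:
  assumes "graph G" "cutvertex G x"
  shows "\<exists>y \<in> verts G. y \<noteq> x"
proof (rule ccontr)
  assume "\<not> (\<exists>y \<in> verts G. y \<noteq> x)"
  then have "verts (pre_digraph.del_vert G x) = {}"
    by (auto simp: pre_digraph.del_vert_def)
  moreover interpret graph G by fact
  interpret D: wf_digraph "del_vert x"
    using subgraph_del_vert[of x] by (rule subgraphE)
  have "D.sccs_verts = {}"
    using D.sccs_verts_empty calculation by simp
  then show False using assms(2) by (simp add: cutvertex_def)
qed

lemma (in wf_digraph) sccs_verts_singleton: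
  assumes "verts G \<subseteq> {z}"
  shows "card sccs_verts \<le> 1"
proof -
  have "S = {z}" if "S \<in> sccs_verts" for S
    using sccs_verts_subsets[OF that] assms that subset_singletonD[of S z]
    by (auto simp: sccs_verts_def)
  then have "sccs_verts \<subseteq> {{z}}" by blast
  then have "card sccs_verts \<le> card {{z}}"
    by (intro card_mono) auto
  then show ?thesis by simp
qed

lemma (in graph) not_cutvertex_pair:
  assumes "verts G = {u, v}"
  shows "\<not> cutvertex G z"
proof
  assume z: "cutvertex G z"
  interpret D: wf_digraph "del_vert z"
    using subgraph_del_vert[of z] by (rule subgraphE)
  have "scc_of u \<in> sccs_verts"
    using assms by (intro scc_of_in_sccs_verts) simp
  then have "0 < card sccs_verts"
    using finite_sccs_verts by (auto simp: card_gt_0_iff)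
  moreover have "verts (del_vert z) \<subseteq> {u} \<or> verts (del_vert z) \<subseteq> {v}"
    using z assms by (auto simp: cutvertex_def pre_digraph.del_vert_def)
  then have "card D.sccs_verts \<le> 1"
    using D.sccs_verts_singleton by blast
  ultimately show False
    using z by (simp add: cutvertex_def)
qed

text \<open>
  Enlarging a subgraph increases the total number of its vertices and arcs, which is bounded by that
  of the whole graph.
\<close>

lemma (in graph) max_subgraph_exists:
  assumes "subgraph K G" "P K"
  shows "\<exists>H. max_subgraph P H \<and> subgraph K H"
proof -
  let ?S = "{H. subgraph H G \<and> P H \<and> subgraph K H}"
  let ?m = "\<lambda>H :: ('a, 'b) pre_digraph. card (verts H) + card (arcs H)"
  have "K \<in> ?S"
    using assms wf_digraph.subgraph_refl[of K] by (auto simp: subgraph_def)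
  moreover have bound: "?m H < Suc (?m G)" if "subgraph H G" for H
    using that by (intro le_imp_less_Suc add_mono card_mono) (auto simp: subgraph_def)
  ultimately obtain H where H: "H \<in> ?S" "\<And>H'. H' \<in> ?S \<Longrightarrow> ?m H' \<le> ?m H"
    using ex_has_greatest_nat[of "\<lambda>H. H \<in> ?S" K ?m "Suc (?m G)"] by blast
  have "H' = H" if H': "subgraph H H'" "subgraph H' G" "P H'" for H'
  proof -
    have "H' \<in> ?S" using H' H(1) subgraph_trans by blast
    then have m: "?m H' \<le> ?m H" by (rule H(2))
    have sub: "verts H \<subseteq> verts H'" "arcs H \<subseteq> arcs H'"
      and fin: "finite (verts H')" "finite (arcs H')"
      using H' finite_subset[OF _ finite_verts] finite_subset[OF _ finite_arcs]
      by (auto simp: subgraph_def)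
    have "card (verts H) \<le> card (verts H')" "card (arcs H) \<le> card (arcs H')"
      using sub fin by (auto intro: card_mono)
    then have "card (verts H) = card (verts H')" "card (arcs H) = card (arcs H')"
      using m by auto
    then have "verts H = verts H'" "arcs H = arcs H'"
      using sub fin by (auto simp: card_subset_eq)
    then show "H' = H"
      using H'(1) by (simp add: subgraph_def compatible_def)
  qed
  then have "max_subgraph P H"
    using H(1) unfolding max_subgraph_def by blast
  then show ?thesis using H(1) by blast
qed

text \<open>
  A single edge is connected and has no cutvertex, because deleting one end leaves one component.
  Hence it extends to a block.
\<close>

lemma (in graph) edge_in_block:
  assumes "u \<rightarrow> v"
  shows "\<exists>B \<in> blocks G. u \<rightarrow>\<^bsub>B\<^esub> v"
proof -
  let ?K = "G \<restriction> {u, v}"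
  have uv: "{u, v} \<subseteq> verts G"
    using adj_in_verts[OF assms] by simp
  have ind: "induced_subgraph ?K G"
    using uv by (rule induced_induce)
  interpret K: digraph ?K using ind by (rule digraphI_induced)
  interpret K: sym_digraph ?K using ind by (rule induced_graph_imp_graph)
  interpret K: graph ?K by unfold_locales
  have arc: "u \<rightarrow>\<^bsub>?K\<^esub> v"
    using assms by (auto simp: arcs_ends_conv)
  then have "strongly_connected ?K"
    using K.graph_symmetric[OF arc] by (intro strongly_connectedI) auto
  then have "Digraph_Component.connected ?K"
    by (auto intro!: K.connectedI K.reachable_mk_symmetricI simp: strongly_connected_def)
  moreover have "graph ?K" by unfold_locales
  moreover have "\<not> (\<exists>z. cutvertex ?K z)"
    using K.not_cutvertex_pair[of u v] by simp
  moreover have "subgraph ?K G" using ind by (rule induced_imp_subgraph)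
  ultimately obtain B where "B \<in> blocks G" "subgraph ?K B"
    using max_subgraph_exists[of ?K "\<lambda>H. graph H \<and> Digraph_Component.connected H \<and> \<not> (\<exists>v. cutvertex H v)"]
    unfolding blocks_def by blast
  then show ?thesis using arc arcs_ends_mono by blast
qed

locale block_fan = graph G for G :: "('a, 'b) pre_digraph" (structure) +
  fixes x :: 'a
  assumes fan: "multipartite_block_fan G x"
begin

lemma block_subgraph: "B \<in> blocks G \<Longrightarrow> subgraph B G"
  by (simp add: blocks_def max_subgraph_def)

lemma block_multipartite: "B \<in> blocks G \<Longrightarrow> complete_multipartite B"
  using fan by (simp add: multipartite_block_fan_def block_complete_multipartite_def)

lemma centre_in_block: "B \<in> blocks G \<Longrightarrow> x \<in> verts B"
  using fan by (simp add: multipartite_block_fan_def)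

lemma blocks_meet:
  assumes "B \<in> blocks G" "B' \<in> blocks G" "B \<noteq> B'" "u \<in> verts B" "u \<in> verts B'"
  shows "u = x"
proof -
  have "verts B \<inter> verts B' = {x}"
    using fan assms(1-3) by (simp add: multipartite_block_fan_def)
  then show ?thesis using assms(4,5) by blast
qed

lemma edge_block_verts:
  assumes "u \<rightarrow> v"
  obtains B where "B \<in> blocks G" "u \<in> verts B" "v \<in> verts B" "u \<rightarrow>\<^bsub>B\<^esub> v"
proof -
  obtain B where B: "B \<in> blocks G" "u \<rightarrow>\<^bsub>B\<^esub> v"
    using edge_in_block[OF assms] by blast
  moreover have "wf_digraph B"
    using block_subgraph[OF B(1)] by (rule subgraphE)
  ultimately show thesis
    using that wf_digraph.adj_in_verts[OF _ B(2)] by blast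
qed

text \<open>
  An edge between two vertices of \<open>B\<close> lies in some block. A block other than \<open>B\<close> shares only \<open>x\<close> with
  \<open>B\<close> and so cannot contain both ends.
\<close>

lemma block_induced:
  assumes "B \<in> blocks G" "u \<in> verts B" "v \<in> verts B"
  shows "u \<rightarrow> v \<longleftrightarrow> u \<rightarrow>\<^bsub>B\<^esub> v"
proof
  assume uv: "u \<rightarrow> v"
  then obtain B' where B': "B' \<in> blocks G" "u \<in> verts B'" "v \<in> verts B'" "u \<rightarrow>\<^bsub>B'\<^esub> v"
    by (rule edge_block_verts)
  have "u \<noteq> v" using uv adj_not_same by blast
  then have "B' = B"
    using blocks_meet[OF assms(1) B'(1)] assms(2,3) B'(2,3) by metis
  then show "u \<rightarrow>\<^bsub>B\<^esub> v" using B' by simp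
next
  show "u \<rightarrow>\<^bsub>B\<^esub> v \<Longrightarrow> u \<rightarrow> v"
    using arcs_ends_mono[OF block_subgraph[OF assms(1)]] by blast
qed

lemma not_adjacent_across_blocks:
  assumes "B \<in> blocks G" "B' \<in> blocks G" "B \<noteq> B'" "u \<in> verts B" "v \<in> verts B'" "u \<noteq> x" "v \<noteq> x"
  shows "\<not> u \<rightarrow> v"
proof
  assume "u \<rightarrow> v"
  then obtain C where C: "C \<in> blocks G" "u \<in> verts C" "v \<in> verts C"
    by (rule edge_block_verts)
  have "C = B" using blocks_meet[OF C(1) assms(1)] C(2) assms(4,6) by blast
  moreover have "C = B'" using blocks_meet[OF C(1) assms(2)] C(3) assms(5,7) by blast
  ultimately show False using assms(3) by simp
qed

lemma centre_in_verts: "x \<in> verts G"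
  using fan by (simp add: multipartite_block_fan_def cutvertex_def)

lemma vertex_in_block:
  assumes "v \<in> verts G" "v \<noteq> x"
  obtains B where "B \<in> blocks G" "v \<in> verts B"
proof -
  have "Digraph_Component.connected G"
    using fan by (simp add: multipartite_block_fan_def block_complete_multipartite_def)
  then have "strongly_connected G"
    using sym_arcs by (intro symmetric_connected_imp_strongly_connected)
  then have "v \<rightarrow>\<^sup>* x"
    using assms centre_in_verts by (simp add: strongly_connected_def)
  then obtain w where "v \<rightarrow> w"
    using assms(2) by (cases rule: converse_reachable_cases) auto
  then show thesis using that by (rule edge_block_verts)
qed

lemma block_verts: "B \<in> blocks G \<Longrightarrow> verts B \<subseteq> verts G"
  using block_subgraph by (rule subgraph_imp_subverts)

lemma other_vertex: "\<exists>y \<in> verts G. y \<noteq> x"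
  using fan graph_axioms
  by (intro cutvertex_imp_two_verts) (auto simp: multipartite_block_fan_def block_complete_multipartite_def)

lemma block_partition:
  assumes "B \<in> blocks G"
  shows "complete_multipartition B (partite_classes B)"
  using block_multipartite[OF assms] partite_classes_eq unfolding complete_multipartite_def by metis

end


section \<open>Three special blocks are too many\<close>

text \<open>
  In a block that counts for \<open>rho\<close>, the centre \<open>x\<close> has a twin \<open>y\<close> in its own class, and two further
  classes provide \<open>u\<close> and \<open>w\<close> that form a triangle with \<open>x\<close> and one with \<open>y\<close>.
\<close>

lemma special_block_witnesses:
  assumes P: "complete_multipartition B (partite_classes B)" and x: "x \<in> verts B"
    and card: "3 \<le> card (partite_classes B)" "2 \<le> card (partite_class B x)"
  shows "\<exists>y \<in> verts B. \<exists>u \<in> verts B. \<exists>w \<in> verts B.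
    y \<noteq> x \<and> \<not> (x \<rightarrow>\<^bsub>B\<^esub> y) \<and> (x \<rightarrow>\<^bsub>B\<^esub> u) \<and> (x \<rightarrow>\<^bsub>B\<^esub> w) \<and>
    (u \<rightarrow>\<^bsub>B\<^esub> w) \<and> (y \<rightarrow>\<^bsub>B\<^esub> u) \<and> (y \<rightarrow>\<^bsub>B\<^esub> w)"
proof -
  let ?P = "partite_classes B"
  have part: "partition_on (verts B) ?P"
    and adj: "\<And>u v. u \<in> verts B \<Longrightarrow> v \<in> verts B \<Longrightarrow>
      u \<rightarrow>\<^bsub>B\<^esub> v \<longleftrightarrow> \<not> (\<exists>C \<in> ?P. u \<in> C \<and> v \<in> C)"
    using P by (auto simp: complete_multipartition_def)
  obtain C where C: "C \<in> ?P" "x \<in> C"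
    using part x by (auto simp: partition_on_def)
  have "2 \<le> card C"
    using card(2) partite_class_eq[OF P C] by simp
  then have "\<not> C \<subseteq> {x}"
    using card_mono[of "{x}" C] by auto
  then obtain y where y: "y \<in> C" "y \<noteq> x" by auto
  have "\<not> ?P \<subseteq> {C}"
    using card(1) card_mono[of "{C}" ?P] by auto
  then obtain D where D: "D \<in> ?P" "D \<noteq> C" by auto
  have "\<not> ?P \<subseteq> {C, D}"
    using card(1) card_mono[of "{C, D}" ?P] D(2) by auto
  then obtain E where E: "E \<in> ?P" "E \<noteq> C" "E \<noteq> D" by auto
  have sub: "X \<subseteq> verts B" "X \<noteq> {}" if "X \<in> ?P" for X
    using part that by (auto simp: partition_on_def)
  obtain u w where uw: "u \<in> D" "w \<in> E" using sub(2)[OF D(1)] sub(2)[OF E(1)] by auto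
  have same: "X = Y" if "X \<in> ?P" "Y \<in> ?P" "v \<in> X" "v \<in> Y" for X Y v
    using part that by (auto simp: partition_on_def disjoint_def)
  have adjI: "v \<rightarrow>\<^bsub>B\<^esub> v'" if "X \<in> ?P" "Y \<in> ?P" "v \<in> X" "v' \<in> Y" "X \<noteq> Y" for X Y v v'
  proof -
    have "v \<in> verts B" "v' \<in> verts B" using that sub by auto
    moreover have "\<not> (\<exists>Z \<in> ?P. v \<in> Z \<and> v' \<in> Z)" using same that by metis
    ultimately show ?thesis using adj by blast
  qed
  have "y \<in> verts B" "u \<in> verts B" "w \<in> verts B"
    using sub C D E y uw by blast+
  moreover have "\<not> x \<rightarrow>\<^bsub>B\<^esub> y"
    using adj[OF x \<open>y \<in> verts B\<close>] C y by blast
  moreover have "x \<rightarrow>\<^bsub>B\<^esub> u" "x \<rightarrow>\<^bsub>B\<^esub> w" "u \<rightarrow>\<^bsub>B\<^esub> w" "y \<rightarrow>\<^bsub>B\<^esub> u" "y \<rightarrow>\<^bsub>B\<^esub> w"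
    using adjI[OF C(1) D(1) C(2) uw(1)] adjI[OF C(1) E(1) C(2) uw(2)] adjI[OF D(1) E(1) uw]
      adjI[OF C(1) D(1) y(1) uw(1)] adjI[OF C(1) E(1) y(1) uw(2)] D E by auto
  ultimately show ?thesis using y(2) by blast
qed

text \<open>
  Each of three special blocks contributes a twin of \<open>x\<close>. The twins of the first two would both have
  to hang at the centre of the triangle in the third block while being at distance 4 from each other.
\<close>

lemma (in block_fan) exact_leaf_power_imp_rho_le:
  assumes "exact_leaf_power 6 G"
  shows "rho G x \<le> 2"
proof (rule ccontr)
  assume "\<not> rho G x \<le> 2"
  let ?S = "{B \<in> blocks G. 3 \<le> card (partite_classes B) \<and> 2 \<le> card (partite_class B x)}"
  obtain S where S: "S \<subseteq> ?S" "card S = 3"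
    using obtain_subset_with_card_n[of 3 ?S] \<open>\<not> rho G x \<le> 2\<close> unfolding rho_def by auto
  obtain d where metric: "leaf_metric (verts G) d"
    and adj: "\<And>u v. u \<in> verts G \<Longrightarrow> v \<in> verts G \<Longrightarrow> u \<noteq> v \<Longrightarrow> u \<rightarrow> v \<longleftrightarrow> d u v = 6"
    using exact_leaf_power_leaf_metric[OF assms] by blast
  interpret leaf_metric "verts G" d by (fact metric)
  have block: "B \<in> blocks G" if "B \<in> S" for B using that S by auto
  have "\<forall>B \<in> S. \<exists>y u w. y \<in> verts B \<and> u \<in> verts B \<and> w \<in> verts B \<and>
    y \<noteq> x \<and> \<not> (x \<rightarrow>\<^bsub>B\<^esub> y) \<and> (x \<rightarrow>\<^bsub>B\<^esub> u) \<and> (x \<rightarrow>\<^bsub>B\<^esub> w) \<and>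
    (u \<rightarrow>\<^bsub>B\<^esub> w) \<and> (y \<rightarrow>\<^bsub>B\<^esub> u) \<and> (y \<rightarrow>\<^bsub>B\<^esub> w)"
  proof
    fix B assume B: "B \<in> S"
    show "\<exists>y u w. y \<in> verts B \<and> u \<in> verts B \<and> w \<in> verts B \<and>
      y \<noteq> x \<and> \<not> (x \<rightarrow>\<^bsub>B\<^esub> y) \<and> (x \<rightarrow>\<^bsub>B\<^esub> u) \<and> (x \<rightarrow>\<^bsub>B\<^esub> w) \<and>
      (u \<rightarrow>\<^bsub>B\<^esub> w) \<and> (y \<rightarrow>\<^bsub>B\<^esub> u) \<and> (y \<rightarrow>\<^bsub>B\<^esub> w)"
      using special_block_witnesses[OF block_partition[OF block[OF B]] centre_in_block[OF block[OF B]]]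
        B S(1) by blast
  qed
  then obtain y u w where "\<forall>B \<in> S. y B \<in> verts B \<and> u B \<in> verts B \<and> w B \<in> verts B \<and>
    y B \<noteq> x \<and> \<not> (x \<rightarrow>\<^bsub>B\<^esub> y B) \<and> (x \<rightarrow>\<^bsub>B\<^esub> u B) \<and> (x \<rightarrow>\<^bsub>B\<^esub> w B) \<and>
    (u B \<rightarrow>\<^bsub>B\<^esub> w B) \<and> (y B \<rightarrow>\<^bsub>B\<^esub> u B) \<and> (y B \<rightarrow>\<^bsub>B\<^esub> w B)"
    by metis
  then have inB: "y B \<in> verts B" "u B \<in> verts B" "w B \<in> verts B"
    and yx: "y B \<noteq> x" "\<not> x \<rightarrow> y B"
    and edges: "x \<rightarrow> u B" "x \<rightarrow> w B" "u B \<rightarrow> w B" "y B \<rightarrow> u B" "y B \<rightarrow> w B"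
    if "B \<in> S" for B
    using that block_induced[OF block[OF that]] centre_in_block[OF block[OF that]] by blast+
  have inV: "y B \<in> verts G" "u B \<in> verts G" "w B \<in> verts G" if "B \<in> S" for B
    using inB[OF that] block_verts[OF block[OF that]] by blast+
  have six: "d a b = 6" if "a \<rightarrow> b" for a b
    using adj adj_in_verts[OF that] that adj_not_same by metis
  have not_six: "d a b \<noteq> 6" if "\<not> a \<rightarrow> b" "a \<in> verts G" "b \<in> verts G" "a \<noteq> b" for a b
    using adj that by blast
  have six': "d x (u B) = 6" "d x (w B) = 6" "d (u B) (w B) = 6" "d (y B) (u B) = 6" "d (y B) (w B) = 6"
    if "B \<in> S" for B
    using edges[OF that] six by blast+
  have ux: "u B \<noteq> x" "w B \<noteq> x" if "B \<in> S" for B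
    using edges[OF that] adj_not_same by metis+
  have across: "a \<noteq> b" "d a b \<noteq> 6"
    if "B \<in> S" "B' \<in> S" "B \<noteq> B'" "a \<in> verts B" "b \<in> verts B'" "a \<noteq> x" "b \<noteq> x" for a b B B'
  proof -
    have B: "B \<in> blocks G" "B' \<in> blocks G" using block that by auto
    show ne: "a \<noteq> b" using blocks_meet[OF B] that by blast
    show "d a b \<noteq> 6"
      using not_six not_adjacent_across_blocks[OF B that(3-7)] block_verts[OF B(1)] block_verts[OF B(2)] that(4,5) ne
      by blast
  qed
  \<comment> \<open>The vertex \<open>u B'\<close> of another special block separates \<open>x\<close> from its twin \<open>y B\<close>.\<close>
  have four: "d x (y B) = 4" if B: "B \<in> S" "B' \<in> S" "B \<noteq> B'" for B B'
    by (rule twin_distance[of x "y B" "u B" "w B" "u B'"])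
      (use inV[OF B(1)] inV[OF B(2)] six'[OF B(1)] six'[OF B(2)] yx[OF B(1)] ux[OF B(2)]
        across[OF B inB(1)[OF B(1)] inB(2)[OF B(2)]] centre_in_verts
        not_six[OF yx(2)[OF B(1)] centre_in_verts inV(1)[OF B(1)]] in auto)
  have place: "d (y B) (y B') = 4" "d (y B) (u B') = 4" "d (y B) (w B') = 4"
    if B: "B \<in> S" "B' \<in> S" "B \<noteq> B'" for B B'
  proof -
    note facts = inV[OF B(1)] inV[OF B(2)] six'[OF B(2)] yx(1)[OF B(1)] yx(1)[OF B(2)]
      across[OF B inB(1)[OF B(1)] inB(1)[OF B(2)]] across[OF B inB(1)[OF B(1)] inB(2)[OF B(2)]]
      across[OF B inB(1)[OF B(1)] inB(3)[OF B(2)]] centre_in_verts ux[OF B(2)]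
      four[OF B] four[OF B(2,1) B(3)[symmetric]]
    show "d (y B) (y B') = 4" "d (y B) (u B') = 4" "d (y B) (w B') = 4"
      by (rule twin_of_other_triangle[of x "y B" "y B'" "u B'" "w B'"]; use facts in auto)+
  qed
  obtain B1 B2 B3 where "S = {B1, B2, B3}" "B1 \<noteq> B2" "B2 \<noteq> B3" "B1 \<noteq> B3"
    using S(2) by (auto simp: card_3_iff)
  then show False
    using no_two_twins_at_triangle[of "y B1" "y B2" "u B3" "w B3"] inV[of B1] inV[of B2] inV[of B3]
      place[of B1 B2] place[of B1 B3] place[of B2 B3] six'[of B3] by simp
qed


section \<open>Leaf powers from placements\<close>

lemma trie_coords_imp_undirected_tree:
  assumes "graph T" "trie_coords T \<phi>" "verts T \<noteq> {}"
  shows "undirected_tree T"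
proof -
  interpret graph T by fact
  have "strongly_connected T"
    using assms(2,3) by (rule trie_coords_strongly_connected)
  then have "Digraph_Component.connected T"
    by (auto intro!: connectedI reachable_mk_symmetricI simp: strongly_connected_def)
  then show ?thesis
    using trie_coords_acyclic[OF assms(2)] graph_axioms unfolding undirected_tree_def by blast
qed

text \<open>
  The leaf of \<open>u\<close> is attached to its place as a child named \<open>Inl u\<close>, and these names are distinct, so
  each of the two leaf edges lengthens the path by one.
\<close>

lemma prefix_dist_of_leaves:
  "u \<noteq> v \<Longrightarrow> prefix_dist (map Inr xs @ [Inl u]) (map Inr ys @ [Inl v]) = prefix_dist xs ys + 2"
proof (induction xs ys rule: lcp_length.induct)
  case (2 bs)
  then show ?case by (cases bs) auto
qed auto

definition leaf_coords :: "('a \<Rightarrow> nat list) \<Rightarrow> 'a + nat \<Rightarrow> ('a + nat) list" where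
  "leaf_coords p = case_sum (\<lambda>u. map Inr (p u) @ [Inl u]) (\<lambda>n. map Inr (from_nat n :: nat list))"

text \<open>
  The tree consists of all prefixes of the places of the vertices, coded as natural numbers, and one
  leaf \<open>Inl v\<close> below the place of each \<open>v\<close>.
\<close>

definition placement_tree :: "'a set \<Rightarrow> ('a \<Rightarrow> nat list) \<Rightarrow> ('a + nat) pair_pre_digraph" where
  "placement_tree V p =
    (let N = Inl ` V \<union> (\<Union>u \<in> V. (\<lambda>n. Inr (to_nat (take n (p u)))) ` {..length (p u)})
     in \<lparr>pverts = N, parcs = {(a, b) \<in> N \<times> N.
           \<exists>c. leaf_coords p b = leaf_coords p a @ [c] \<or> leaf_coords p a = leaf_coords p b @ [c]}\<rparr>)"

lemma leaf_coords_simps [simp]: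
  "leaf_coords p (Inl u) = map Inr (p u) @ [Inl u]"
  "leaf_coords p (Inr n) = map Inr (from_nat n :: nat list)"
  by (simp_all add: leaf_coords_def)

lemma pverts_placement_tree:
  "pverts (placement_tree V p) =
    Inl ` V \<union> (\<Union>u \<in> V. (\<lambda>n. Inr (to_nat (take n (p u)))) ` {..length (p u)})"
  by (simp add: placement_tree_def Let_def)

lemma parcs_placement_tree:
  "(a, b) \<in> parcs (placement_tree V p) \<longleftrightarrow>
    a \<in> pverts (placement_tree V p) \<and> b \<in> pverts (placement_tree V p) \<and>
    (\<exists>c. leaf_coords p b = leaf_coords p a @ [c] \<or> leaf_coords p a = leaf_coords p b @ [c])"
  by (simp add: placement_tree_def Let_def)

lemma graph_placement_tree:
  assumes "finite V"
  shows "graph (with_proj (placement_tree V p))"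
proof -
  let ?T = "placement_tree V p"
  have fin: "finite (pverts ?T)"
    using assms by (simp add: pverts_placement_tree)
  have sub: "parcs ?T \<subseteq> pverts ?T \<times> pverts ?T"
    using parcs_placement_tree by fast
  interpret pair_graph ?T
  proof
    show "finite (parcs ?T)" using finite_subset[OF sub] fin by simp
    show "finite (pverts ?T)" by (fact fin)
    show "fst e \<in> pverts ?T" "snd e \<in> pverts ?T" if "e \<in> parcs ?T" for e
      using that sub by auto
    show "fst e \<noteq> snd e" if "e \<in> parcs ?T" for e
      using that by (cases e) (auto simp: parcs_placement_tree)
    show "symmetric (with_proj ?T)"
      unfolding symmetric_def by (rule symI) (auto simp: parcs_placement_tree)
  qed
  show ?thesis by unfold_locales
qed

lemma leaf_coords_inj:
  assumes "a \<in> pverts (placement_tree V p)" "b \<in> pverts (placement_tree V p)"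
    and eq: "leaf_coords p a = leaf_coords p b"
  shows "a = b"
proof -
  have inner: "\<exists>xs :: nat list. c = Inr (to_nat xs)" if "c \<in> pverts (placement_tree V p)" "\<forall>u. c \<noteq> Inl u" for c
    using that by (auto simp: pverts_placement_tree)
  have last: "map Inr xs \<noteq> ys @ [Inl u]" for xs :: "nat list" and ys :: "('a + nat) list" and u :: 'a
    by (auto dest!: arg_cong[of _ _ set])
  show ?thesis
  proof (cases a)
    case (Inl u)
    then show ?thesis
      using eq last by (cases b) (auto, metis+)
  next
    case (Inr n)
    then obtain xs :: "nat list" where xs: "a = Inr (to_nat xs)" using inner[OF assms(1)] by auto
    show ?thesis
    proof (cases b)
      case (Inl u)
      then show ?thesis using eq last xs by simp
    next
      case (Inr m)
      then obtain ys :: "nat list" where "b = Inr (to_nat ys)" using inner[OF assms(2)] by auto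
      then show ?thesis using eq xs by (simp add: inj_map_eq_map)
    qed
  qed
qed

lemma trie_coords_placement_tree:
  "trie_coords (with_proj (placement_tree V p)) (leaf_coords p)"
  unfolding trie_coords_def
proof (intro conjI allI impI ballI)
  let ?T = "placement_tree V p"
  show "inj_on (leaf_coords p) (verts (with_proj ?T))"
    by (rule inj_onI) (auto intro: leaf_coords_inj)
  show "u \<rightarrow>\<^bsub>with_proj ?T\<^esub> v \<longleftrightarrow>
      (\<exists>c. leaf_coords p v = leaf_coords p u @ [c] \<or> leaf_coords p u = leaf_coords p v @ [c])"
    if "u \<in> verts (with_proj ?T)" "v \<in> verts (with_proj ?T)" for u v
    using that by (simp add: parcs_placement_tree)
  show "xs \<in> leaf_coords p ` verts (with_proj ?T)"
    if "xs @ [c] \<in> leaf_coords p ` verts (with_proj ?T)" for xs c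
  proof -
    have take_in: "map Inr (take n (p u)) \<in> leaf_coords p ` verts (with_proj ?T)" if "u \<in> V" for u n
    proof (rule image_eqI)
      show "map Inr (take n (p u)) = leaf_coords p (Inr (to_nat (take (min n (length (p u))) (p u))))"
        by (simp add: min_def)
      show "Inr (to_nat (take (min n (length (p u))) (p u))) \<in> verts (with_proj ?T)"
        using that by (force simp: pverts_placement_tree)
    qed
    from that obtain a where a: "a \<in> pverts ?T" "xs @ [c] = leaf_coords p a"
      by auto
    then consider u where "u \<in> V" "a = Inl u" | u n where "u \<in> V" "a = Inr (to_nat (take n (p u)))"
      by (auto simp: pverts_placement_tree)
    then show ?thesis
    proof cases
      case 1
      then show ?thesis using a(2) take_in[OF 1(1), of "length (p u)"] by simp
    next
      case 2
      then have eq: "xs @ [c] = map Inr (take n (p u))" using a(2) by simp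
      then have "xs = butlast (map Inr (take n (p u)))" by (metis butlast_snoc)
      then have "xs = map Inr (take (min n (length (p u)) - 1) (p u))"
        by (auto simp: butlast_conv_take take_map min_def)
      then show ?thesis using take_in[OF 2(1)] by simp
    qed
  qed
qed

text \<open>
  A placement of the vertices in the tree of lists yields a leaf power as soon as adjacency means
  distance \<open>k - 2\<close> between places, since the two leaf edges account for the rest. Every inner vertex has
  a child towards some leaf and, unless it is the root, a parent. The root must not become a leaf of
  the tree either: the vertex \<open>x\<close> placed there and the second vertex \<open>y\<close> give it two children.
\<close>

lemma placement_imp_exact_leaf_power:
  fixes p :: "'a \<Rightarrow> nat list"
  assumes "graph G" and x: "x \<in> verts G" "p x = []" and y: "y \<in> verts G" "y \<noteq> x"
    and adj: "\<And>u v. u \<in> verts G \<Longrightarrow> v \<in> verts G \<Longrightarrow> u \<noteq> v \<Longrightarrow>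
      u \<rightarrow>\<^bsub>G\<^esub> v \<longleftrightarrow> prefix_dist (p u) (p v) + 2 = k"
  shows "exact_leaf_power k G"
proof -
  interpret G: graph G by fact
  let ?V = "verts G"
  let ?T = "placement_tree ?V p"
  let ?\<phi> = "leaf_coords p"
  interpret T: graph "with_proj ?T"
    by (rule graph_placement_tree) simp
  note \<phi> = trie_coords_placement_tree[of ?V p]
  have Inl_in: "Inl u \<in> verts (with_proj ?T) \<longleftrightarrow> u \<in> ?V" for u
    by (auto simp: pverts_placement_tree)
  have tree: "undirected_tree (with_proj ?T)"
    using x(1) Inl_in by (intro trie_coords_imp_undirected_tree[OF _ \<phi>] T.graph_axioms) blast
  have edge: "u \<rightarrow>\<^bsub>with_proj ?T\<^esub> v \<longleftrightarrow>
      (\<exists>c. ?\<phi> v = ?\<phi> u @ [c] \<or> ?\<phi> u = ?\<phi> v @ [c])"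
    if "u \<in> verts (with_proj ?T)" "v \<in> verts (with_proj ?T)" for u v
    using trie_coordsD(3)[OF \<phi> that] .
  have leaf: "out_degree (with_proj ?T) (Inl u) = 1" if u: "u \<in> ?V" for u
  proof -
    let ?q = "Inr (to_nat (p u)) :: 'a + nat"
    have q: "?q \<in> verts (with_proj ?T)"
      using u by (auto simp: pverts_placement_tree intro!: bexI[of _ u] image_eqI[of _ _ "length (p u)"])
    have "out_arcs (with_proj ?T) (Inl u) = {(Inl u, ?q)}"
    proof (intro equalityI subsetI)
      fix e assume "e \<in> out_arcs (with_proj ?T) (Inl u)"
      then obtain w where w: "e = (Inl u, w)" "(Inl u, w) \<in> parcs ?T" by (cases e) auto
      then obtain c where w_in: "w \<in> pverts ?T"
        and c: "?\<phi> w = ?\<phi> (Inl u) @ [c] \<or> ?\<phi> (Inl u) = ?\<phi> w @ [c]"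
        by (auto simp: parcs_placement_tree)
      have "Inl u \<notin> set (butlast (?\<phi> w))"
        by (cases w) (auto dest: in_set_butlastD)
      then have "?\<phi> w \<noteq> ?\<phi> (Inl u) @ [c]" by (auto simp: butlast_append)
      then have "?\<phi> w = ?\<phi> ?q" using c by simp
      then have "w = ?q" using leaf_coords_inj[OF w_in] q by simp
      then show "e \<in> {(Inl u, ?q)}" using w(1) by simp
    next
      fix e :: "('a + nat) \<times> ('a + nat)" assume "e \<in> {(Inl u, ?q)}"
      moreover have "(Inl u, ?q) \<in> parcs ?T"
        using edge[of "Inl u" ?q] q u Inl_in[of u] by simp
      ultimately show "e \<in> out_arcs (with_proj ?T) (Inl u)" by simp
    qed
    then show ?thesis by (simp add: out_degree_def)
  qed
  have not_leaf: "out_degree (with_proj ?T) a \<noteq> 1"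
    if a: "a \<in> verts (with_proj ?T)" "\<forall>u. a \<noteq> Inl u" for a :: "'a + nat"
  proof
    assume "out_degree (with_proj ?T) a = 1"
    then have uniq: "w = w'" if "a \<rightarrow>\<^bsub>with_proj ?T\<^esub> w" "a \<rightarrow>\<^bsub>with_proj ?T\<^esub> w'" for w w'
      using T.leaf_neighbour that by metis
    obtain u n where u: "u \<in> ?V" "n \<le> length (p u)" "a = Inr (to_nat (take n (p u)))"
      using a by (auto simp: pverts_placement_tree)
    have child: "\<exists>w \<in> verts (with_proj ?T). ?\<phi> w = take (Suc n) (?\<phi> (Inl v)) \<and> a \<rightarrow>\<^bsub>with_proj ?T\<^esub> w"
      if "v \<in> ?V" "n \<le> length (p v)" "take n (p v) = take n (p u)" for v
    proof -
      have "?\<phi> (Inl v) \<in> ?\<phi> ` verts (with_proj ?T)"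
        using Inl_in[of v] that(1) by (intro imageI) simp
      then have "take (Suc n) (?\<phi> (Inl v)) \<in> ?\<phi> ` verts (with_proj ?T)"
        by (rule trie_coords_take[OF \<phi>])
      then obtain w where w: "w \<in> verts (with_proj ?T)" "?\<phi> w = take (Suc n) (?\<phi> (Inl v))"
        by auto
      have "take (Suc n) (?\<phi> (Inl v)) = take n (?\<phi> (Inl v)) @ [?\<phi> (Inl v) ! n]"
        using that(2) by (intro take_Suc_conv_app_nth) simp
      moreover have "take n (?\<phi> (Inl v)) = ?\<phi> a"
        using that(2,3) u(3) by (simp add: take_map)
      ultimately have "a \<rightarrow>\<^bsub>with_proj ?T\<^esub> w"
        using edge[OF a(1) w(1)] w(2) by metis
      then show ?thesis using w by blast
    qed
    obtain w where w: "w \<in> verts (with_proj ?T)" "?\<phi> w = take (Suc n) (?\<phi> (Inl u))" "a \<rightarrow>\<^bsub>with_proj ?T\<^esub> w"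
      using child[OF u(1,2) refl] by blast
    show False
    proof (cases n)
      case 0
      obtain w1 where w1: "?\<phi> w1 = take (Suc n) (?\<phi> (Inl x))" "a \<rightarrow>\<^bsub>with_proj ?T\<^esub> w1"
        using child[OF x(1)] 0 by auto
      obtain w2 where w2: "?\<phi> w2 = take (Suc n) (?\<phi> (Inl y))" "a \<rightarrow>\<^bsub>with_proj ?T\<^esub> w2"
        using child[OF y(1)] 0 by auto
      have "take (Suc n) (?\<phi> (Inl x)) \<noteq> take (Suc n) (?\<phi> (Inl y))"
        using 0 x(2) y(2) by (cases "p y") auto
      then show False using w1 w2 uniq by metis
    next
      case (Suc m)
      have "take n (p u) \<noteq> []" using Suc u(2) by auto
      then have "?\<phi> a = butlast (?\<phi> a) @ [last (?\<phi> a)]"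
        using u(3) by simp
      moreover have "?\<phi> a \<in> ?\<phi> ` verts (with_proj ?T)"
        using a(1) by simp
      ultimately obtain q where q: "q \<in> verts (with_proj ?T)" "?\<phi> q = butlast (?\<phi> a)"
        using trie_coordsD(2)[OF \<phi>] by (metis imageE)
      then have "a \<rightarrow>\<^bsub>with_proj ?T\<^esub> q"
        using edge[OF a(1) q(1)] \<open>?\<phi> a = _\<close> by metis
      then have "q = w" using uniq w(3) by blast
      moreover have "length (?\<phi> w) = Suc n"
        unfolding w(2) using u(2) by simp
      moreover have "length (?\<phi> q) \<le> n"
        unfolding q(2) using u by simp
      ultimately show False by simp
    qed
  qed
  have "a \<in> leaves (with_proj ?T) \<longleftrightarrow> a \<in> Inl ` ?V" for a
  proof (cases a)
    case (Inl u)
    then show ?thesis using leaf[of u] Inl_in[of u] by (auto simp: leaves_def)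
  next
    case (Inr n)
    then show ?thesis using not_leaf[of a] by (auto simp: leaves_def)
  qed
  then have "leaves (with_proj ?T) = Inl ` ?V" by blast
  moreover have "u \<rightarrow>\<^bsub>G\<^esub> v \<longleftrightarrow> wf_digraph.\<mu> (with_proj ?T) (\<lambda>_. 1) (Inl u) (Inl v) = ereal (real k)"
    if "u \<in> ?V" "v \<in> ?V" "u \<noteq> v" for u v
  proof -
    have "wf_digraph.\<mu> (with_proj ?T) (\<lambda>_. 1) (Inl u) (Inl v) = ereal (real (prefix_dist (p u) (p v) + 2))"
      using T.trie_coords_mu[OF \<phi>, of "Inl u" "Inl v"] Inl_in that
      by (simp add: prefix_dist_of_leaves[OF that(3)] del: of_nat_add)
    then show ?thesis
      using adj[OF that] by (simp only: ereal.inject of_nat_eq_iff)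
  qed
  ultimately show ?thesis
    using tree G.graph_axioms unfolding exact_leaf_power_def by blast
qed


section \<open>Placing a fan with at most two special blocks\<close>

lemma partite_class_in_classes:
  assumes "complete_multipartition B P" "u \<in> verts B"
  shows "partite_class B u \<in> P" "u \<in> partite_class B u"
proof -
  have "\<Union> P = verts B"
    using assms(1) unfolding complete_multipartition_def partition_on_def by blast
  then obtain C where "C \<in> P" "u \<in> C"
    using assms(2) by blast
  then show "partite_class B u \<in> P" "u \<in> partite_class B u"
    using partite_class_eq[OF assms(1)] by auto
qed

lemma complete_multipartition_adjacent:
  assumes "complete_multipartition B P" "u \<in> verts B" "v \<in> verts B"
  shows "u \<rightarrow>\<^bsub>B\<^esub> v \<longleftrightarrow> partite_class B u \<noteq> partite_class B v"
proof -
  have "E = partite_class B w" if "E \<in> P" "w \<in> E" for E w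
    using partite_class_eq[OF assms(1) that] by simp
  then have "(\<exists>E \<in> P. u \<in> E \<and> v \<in> E) \<longleftrightarrow> partite_class B u = partite_class B v"
    using partite_class_in_classes[OF assms(1,2)] partite_class_in_classes[OF assms(1,3)] by metis
  then show ?thesis
    using assms unfolding complete_multipartition_def by blast
qed

text \<open>
  Natural numbers that name the blocks and the partite classes. The blocks in \<open>special\<close> get the two
  names 0 and 1, which is where the bound on \<open>rho\<close> enters.
\<close>

locale block_fan_codes = block_fan +
  fixes special :: "('a, 'b) pre_digraph set"
    and s t :: "('a, 'b) pre_digraph \<Rightarrow> nat" and c :: "'a set \<Rightarrow> nat"
  assumes special_iff: "B \<in> blocks G \<Longrightarrow>
      B \<in> special \<longleftrightarrow> 3 \<le> card (partite_classes B) \<and> 2 \<le> card (partite_class B x)"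
    and s_less: "B \<in> special \<Longrightarrow> s B < 2"
    and s_inj: "inj_on s special"
    and t_inj: "inj_on t (blocks G)"
    and c_inj: "inj_on c (Pow (verts G))"
begin

text \<open>
  The place at distance 2 from \<open>x\<close> from which the other classes of the block branch off. The two
  special blocks share the intermediate vertex \<open>[0]\<close>; every other block has an arm of its own.
\<close>

definition hub :: "('a, 'b) pre_digraph \<Rightarrow> nat list" where
  "hub B = (if B \<in> special then [0, s B] else [Suc (t B), 0])"

text \<open>
  The place of the vertices other than \<open>x\<close> in the class of \<open>x\<close>. In a special block they sit on the hub
  of the other special block: this has distance 4 to their own neighbours, but 2 to \<open>x\<close>, to the twins
  and to all other vertices of the other special block. If a block that is not special has such
  vertices, then all its other vertices form one class placed at \<open>hub B @ [0, 0]\<close>, and four further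
  steps on the same arm lead to distance 4 from that class and distance 8 from \<open>x\<close>.
\<close>

definition twin_place :: "('a, 'b) pre_digraph \<Rightarrow> nat list" where
  "twin_place B = (if B \<in> special then [0, 1 - s B] else hub B @ [0, 0, 0, 0, 0, 0])"

text \<open>
  One common branch is used when there are at most two classes, so that \<open>twin_place\<close> does not have to
  refer to the name of the second class.
\<close>

definition branch :: "('a, 'b) pre_digraph \<Rightarrow> 'a \<Rightarrow> nat" where
  "branch B v = (if card (partite_classes B) < 3 then 0 else c (partite_class B v))"

definition block_place :: "('a, 'b) pre_digraph \<Rightarrow> 'a \<Rightarrow> nat list" where
  "block_place B v =
    (if partite_class B v = partite_class B x then twin_place B else hub B @ [branch B v, 0])"

definition place :: "'a \<Rightarrow> nat list" where
  "place v = (if v = x then [] else block_place (SOME B. B \<in> blocks G \<and> v \<in> verts B) v)"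

lemma place_centre [simp]: "place x = []"
  by (simp add: place_def)

lemma place_in_block:
  assumes "B \<in> blocks G" "v \<in> verts B" "v \<noteq> x"
  shows "place v = block_place B v"
proof -
  have "(SOME B. B \<in> blocks G \<and> v \<in> verts B) = B"
    using assms blocks_meet by (intro some_equality) blast+
  then show ?thesis using assms(3) by (simp add: place_def)
qed

lemma adjacent_iff_class:
  assumes "B \<in> blocks G" "u \<in> verts B" "v \<in> verts B"
  shows "u \<rightarrow> v \<longleftrightarrow> partite_class B u \<noteq> partite_class B v"
  using block_induced[OF assms] complete_multipartition_adjacent[OF block_partition[OF assms(1)] assms(2,3)]
  by simp

lemma finite_classes:
  assumes "B \<in> blocks G"
  shows "finite (partite_classes B)" "C \<in> partite_classes B \<Longrightarrow> C \<subseteq> verts G"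
proof -
  have sub: "C \<subseteq> verts G" if "C \<in> partite_classes B" for C
    using block_partition[OF assms] block_verts[OF assms] that
    unfolding complete_multipartition_def partition_on_def by blast
  then show "C \<in> partite_classes B \<Longrightarrow> C \<subseteq> verts G" .
  have "partite_classes B \<subseteq> Pow (verts G)" using sub by blast
  then show "finite (partite_classes B)"
    by (rule finite_subset) simp
qed

lemma branch_eq_iff:
  assumes "B \<in> blocks G" "u \<in> verts B" "v \<in> verts B"
    and "partite_class B u \<noteq> partite_class B x" "partite_class B v \<noteq> partite_class B x"
  shows "branch B u = branch B v \<longleftrightarrow> partite_class B u = partite_class B v"
proof (cases "card (partite_classes B) < 3")
  case True
  note in_classes = partite_class_in_classes(1)[OF block_partition[OF assms(1)]]
  have "partite_class B u = partite_class B v"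
  proof (rule ccontr)
    assume "partite_class B u \<noteq> partite_class B v"
    then have "card {partite_class B x, partite_class B u, partite_class B v} = 3"
      using assms(4)[symmetric] assms(5)[symmetric] by simp
    moreover have sub: "{partite_class B x, partite_class B u, partite_class B v} \<subseteq> partite_classes B"
      using in_classes[OF assms(2)] in_classes[OF assms(3)] in_classes[OF centre_in_block[OF assms(1)]]
      by blast
    ultimately show False
      using True card_mono[OF finite_classes(1)[OF assms(1)] sub] by simp
  qed
  then show ?thesis by (simp add: branch_def)
next
  case False
  have Pow: "partite_class B w \<in> Pow (verts G)" if "w \<in> verts B" for w
    using finite_classes(2)[OF assms(1) partite_class_in_classes(1)[OF block_partition[OF assms(1)] that]]
    by simp
  have "c (partite_class B u) = c (partite_class B v) \<longleftrightarrow> partite_class B u = partite_class B v"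
    by (rule inj_on_eq_iff[OF c_inj Pow[OF assms(2)] Pow[OF assms(3)]])
  then show ?thesis using False by (simp add: branch_def)
qed

text \<open>
  With a twin of \<open>x\<close>, three classes would make the block special.
\<close>

lemma twin_imp_few_classes:
  assumes "B \<in> blocks G" "v \<in> verts B" "v \<noteq> x" "partite_class B v = partite_class B x"
    and "B \<notin> special"
  shows "card (partite_classes B) < 3"
proof -
  note part = block_partition[OF assms(1)]
  have C: "partite_class B x \<in> partite_classes B" "x \<in> partite_class B x" "v \<in> partite_class B x"
    using partite_class_in_classes[OF part] centre_in_block[OF assms(1)] assms(2,4) by metis+
  have "finite (partite_class B x)"
    using finite_classes(2)[OF assms(1) C(1)] finite_verts by (rule finite_subset)
  moreover have "{x, v} \<subseteq> partite_class B x" using C by simp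
  ultimately have "card {x, v} \<le> card (partite_class B x)"
    by (rule card_mono)
  then show ?thesis
    using assms(3,5) special_iff[OF assms(1)] by auto
qed

lemma place_adjacent_in_block:
  assumes B: "B \<in> blocks G" "u \<in> verts B" "v \<in> verts B" and ne: "u \<noteq> x" "v \<noteq> x"
  shows "u \<rightarrow> v \<longleftrightarrow> prefix_dist (place u) (place v) = 4"
proof -
  have few: "branch B w = 0"
    if "w' \<in> verts B" "w' \<noteq> x" "partite_class B w' = partite_class B x" "B \<notin> special" for w w'
    using twin_imp_few_classes[OF B(1) that] by (simp add: branch_def)
  have mixed: "prefix_dist (twin_place B) (hub B @ [branch B w, 0]) = 4"
    if "w' \<in> verts B" "w' \<noteq> x" "partite_class B w' = partite_class B x" for w w'
  proof (cases "B \<in> special")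
    case True
    then have "s B = 0 \<or> s B = 1" using s_less[of B] by linarith
    then show ?thesis using True by (auto simp: twin_place_def hub_def)
  next
    case False
    then show ?thesis using few[OF that False, of w] by (simp add: twin_place_def hub_def)
  qed
  have hubs: "prefix_dist (hub B @ [i, 0]) (hub B @ [j, 0]) = (if i = j then 0 else 4)" for i j
    by (simp add: hub_def)
  consider (twins) "partite_class B u = partite_class B x" "partite_class B v = partite_class B x"
    | (left) "partite_class B u = partite_class B x" "partite_class B v \<noteq> partite_class B x"
    | (right) "partite_class B u \<noteq> partite_class B x" "partite_class B v = partite_class B x"
    | (neither) "partite_class B u \<noteq> partite_class B x" "partite_class B v \<noteq> partite_class B x"
    by blast
  then show ?thesis
    unfolding adjacent_iff_class[OF B] place_in_block[OF B(1,2) ne(1)] place_in_block[OF B(1,3) ne(2)]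
  proof cases
    case twins
    then show "partite_class B u \<noteq> partite_class B v \<longleftrightarrow> prefix_dist (block_place B u) (block_place B v) = 4"
      by (simp add: block_place_def)
  next
    case left
    then show "partite_class B u \<noteq> partite_class B v \<longleftrightarrow> prefix_dist (block_place B u) (block_place B v) = 4"
      using mixed[OF B(2) ne(1)] by (simp add: block_place_def)
  next
    case right
    then show "partite_class B u \<noteq> partite_class B v \<longleftrightarrow> prefix_dist (block_place B u) (block_place B v) = 4"
      using mixed[OF B(3) ne(2)] by (simp add: block_place_def prefix_dist_commute)
  next
    case neither
    then show "partite_class B u \<noteq> partite_class B v \<longleftrightarrow> prefix_dist (block_place B u) (block_place B v) = 4"
      using branch_eq_iff[OF B neither] by (simp add: block_place_def hubs)
  qed
qed

lemma place_adjacent_centre: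
  assumes B: "B \<in> blocks G" "v \<in> verts B" and ne: "v \<noteq> x"
  shows "x \<rightarrow> v \<longleftrightarrow> prefix_dist (place x) (place v) = 4"
  unfolding adjacent_iff_class[OF B(1) centre_in_block[OF B(1)] B(2)] place_in_block[OF B ne]
    block_place_def
  by (auto simp: hub_def twin_place_def)

lemma place_across_blocks:
  assumes B: "B \<in> blocks G" "B' \<in> blocks G" "B \<noteq> B'"
    and u: "u \<in> verts B" "u \<noteq> x" and v: "v \<in> verts B'" "v \<noteq> x"
  shows "prefix_dist (place u) (place v) \<noteq> 4"
proof -
  have "t B \<noteq> t B'" using inj_onD[OF t_inj] B by blast
  moreover have "s B \<noteq> s B'" "s B < 2" "s B' < 2" if "B \<in> special" "B' \<in> special"
    using inj_onD[OF s_inj _ that] B(3) s_less that by blast+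
  ultimately show ?thesis
    unfolding place_in_block[OF B(1) u] place_in_block[OF B(2) v] block_place_def
    by (cases "B \<in> special"; cases "B' \<in> special") (auto simp: hub_def twin_place_def)
qed

lemma place_adjacent:
  assumes u: "u \<in> verts G" and v: "v \<in> verts G" and ne: "u \<noteq> v"
  shows "u \<rightarrow> v \<longleftrightarrow> prefix_dist (place u) (place v) = 4"
proof -
  have centre: "x \<rightarrow> w \<longleftrightarrow> prefix_dist (place x) (place w) = 4" if "w \<in> verts G" "w \<noteq> x" for w
    using vertex_in_block[OF that] place_adjacent_centre that(2) by metis
  consider "u = x" | "v = x" | "u \<noteq> x" "v \<noteq> x" by blast
  then show ?thesis
  proof cases
    case 1
    then show ?thesis using centre v ne by blast
  next
    case 2
    then have "u \<rightarrow> v \<longleftrightarrow> x \<rightarrow> u" using graph_symmetric by blast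
    then show ?thesis using centre[OF u] 2 ne by (simp add: prefix_dist_commute)
  next
    case 3
    obtain B where B: "B \<in> blocks G" "u \<in> verts B" using vertex_in_block[OF u 3(1)] .
    obtain B' where B': "B' \<in> blocks G" "v \<in> verts B'" using vertex_in_block[OF v 3(2)] .
    show ?thesis
    proof (cases "B = B'")
      case True
      then show ?thesis using place_adjacent_in_block B B' 3 by blast
    next
      case False
      then show ?thesis
        using not_adjacent_across_blocks[OF B(1) B'(1) False B(2) B'(2) 3]
          place_across_blocks[OF B(1) B'(1) False B(2) 3(1) B'(2) 3(2)] by blast
    qed
  qed
qed

end

lemma (in block_fan) rho_le_imp_exact_leaf_power:
  assumes "rho G x \<le> 2"
  shows "exact_leaf_power 6 G"
proof -
  let ?S = "{B \<in> blocks G. 3 \<le> card (partite_classes B) \<and> 2 \<le> card (partite_class B x)}"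
  have fin: "finite (blocks G)" "finite ?S"
    using finite_blocks[OF graph_axioms] by auto
  obtain s :: "('a, 'b) pre_digraph \<Rightarrow> nat" where "bij_betw s ?S {0..<card ?S}"
    using ex_bij_betw_finite_nat[OF fin(2)] by (rule exE)
  then have s: "s ` ?S = {0..<card ?S}" "inj_on s ?S"
    by (simp_all only: bij_betw_def)
  obtain t :: "('a, 'b) pre_digraph \<Rightarrow> nat" where "bij_betw t (blocks G) {0..<card (blocks G)}"
    using ex_bij_betw_finite_nat[OF fin(1)] by (rule exE)
  then have t: "inj_on t (blocks G)"
    by (rule bij_betw_imp_inj_on)
  have "finite (Pow (verts G))" by simp
  from ex_bij_betw_finite_nat[OF this] obtain c :: "'a set \<Rightarrow> nat"
    where "bij_betw c (Pow (verts G)) {0..<card (Pow (verts G))}"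
    by (rule exE)
  then have c: "inj_on c (Pow (verts G))"
    by (rule bij_betw_imp_inj_on)
  have "s B < 2" if "B \<in> ?S" for B
  proof -
    have "s B \<in> {0..<card ?S}" unfolding s(1)[symmetric] using that by (rule imageI)
    then show ?thesis using assms by (simp add: rho_def)
  qed
  note s_less = this
  interpret block_fan_codes G x ?S s t c
  proof unfold_locales
    show "B \<in> ?S \<longleftrightarrow> 3 \<le> card (partite_classes B) \<and> 2 \<le> card (partite_class B x)"
      if "B \<in> blocks G" for B
      using that by simp
    show "s B < 2" if "B \<in> ?S" for B
      using that by (rule s_less)
  qed (fact s(2) t c)+
  obtain y where "y \<in> verts G" "y \<noteq> x" using other_vertex by blast
  then show ?thesis
  proof (rule placement_imp_exact_leaf_power[where p = place and x = x, OF graph_axioms centre_in_verts place_centre])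
    show "u \<rightarrow> v \<longleftrightarrow> prefix_dist (place u) (place v) + 2 = 6"
      if "u \<in> verts G" "v \<in> verts G" "u \<noteq> v" for u v
      using place_adjacent[OF that] by simp
  qed
qed

theorem theorem6p10:
  fixes G :: "('a, 'b) pre_digraph" and x :: 'a
  assumes "multipartite_block_fan G x"
  shows "exact_leaf_power 6 G \<longleftrightarrow> rho G x \<le> 2"
proof -
  interpret graph G
    using assms by (simp add: multipartite_block_fan_def block_complete_multipartite_def)
  interpret block_fan G x by unfold_locales (fact assms)
  show ?thesis
    using exact_leaf_power_imp_rho_le rho_le_imp_exact_leaf_power by blast
qed

end
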